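(* Let $\Gamma$ be a finite simple graph on $n$ vertices, let $\mathcal H=\{K_{t_1},\dots,K_{t_n}\}$ be a collection of complete graphs, and let $G=\Gamma\circ\mathcal H$ be the corresponding clique corona graph. If $t_i\ge 2$ for each $i\in\{1,\dots,n\}$, then $\mathrm{HS}_k(J(G))$ is weakly polymatroidal, and thus has linear quotients, for all $k\ge 0$.
   Context: Clique corona graph: let $\Gamma$ be a finite simple graph on the vertex set $\{w_{11},\dots,w_{n1}\}$ and let $\mathcal H=\{K_{t_1},\dots,K_{t_n}\}$, where $K_{t_i}$ is a complete graph on $t_i$ vertices (vertex sets pairwise disjoint and disjoint from $V_\Gamma$). The clique corona graph $G=\Gamma\circ\mathcal H$ has vertex set $V_\Gamma\cup\bigcup_{i=1}^n V_{K_{t_i}}$ and edge set $E_\Gamma\cup\bigcup_{i=1}^nE_{K_{t_i}}\cup\bigcup_{i=1}^n\{\{w_{i1},x\}: x\in V_{K_{t_i}}\}$; that is, $w_{i1}$ is joined to all vertices of $K_{t_i}$. Let $\mathbb{K}$ be a field and identify the vertices of $G$ with the variables of a polynomial ring $R$ over $\mathbb{K}$. A vertex cover of $G$ is a set of vertices meeting every edge; it is minimal if it is minimal with respect to inclusion. For a set $A$ of vertices, $\mathbf{x}_A$ is the product of the variables in $A$. The vertex cover ideal is $J(G)=\langle \mathbf{x}_{\mathcal C} : \mathcal C\text{ a minimal vertex cover of }G\rangle$. For a monomial ideal $I$ with $\mathbb{N}^n$-graded minimal free resolution $0\to F_r\to\cdots\to F_0\to I\to 0$, $F_k=\bigoplus_j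 R(-\mathbf a_{kj})$, the $k$-th homological shift ideal $\mathrm{HS}_k(I)$ is the monomial ideal generated by the monomials $\mathbf{x}^{\mathbf a_{kj}}$ over all $k$-th multigraded shifts $\mathbf a_{kj}$ of $I$ (so $\mathrm{HS}_0(I)=I$, and $\mathrm{HS}_k(I)=0$ if $k>\mathrm{pd}(I)$; the zero ideal satisfies the assertions vacuously). Let $\mathcal G(I)$ be the set of minimal monomial generators of $I$. A monomial ideal $I\subset\mathbb{K}[x_1,\dots,x_N]$ is weakly polymatroidal (with respect to the order of variables $x_1>\dots>x_N$) if for any two minimal monomial generators $u=x_1^{\alpha_1}\cdots x_N^{\alpha_N}>_{\mathrm{lex}}v=x_1^{\beta_1}\cdots x_N^{\beta_N}$ with $\alpha_1=\beta_1,\dots,\alpha_{t-1}=\beta_{t-1}$ and $\alpha_t>\beta_t$ for some $t$, there exists $j>t$ (with $x_j\mid v$) such that $x_t(v/x_j)\in\mathcal G(I)$. Here an ideal in a polynomial ring whose variables are the vertices of a graph is called weakly polymatroidal if it is so for some total ordering of the variables. $I$ has linear quotients if there is a total order $m_1>\dots>m_r$ on $\mathcal G(I)$ such that each colon ideal $\langle m_1,\dots,m_j\rangle:m_{j+1}$, $1\le j\le r-1$, is generated by variables. *)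

theory Defs
  imports "Jordan_Normal_Form.Matrix" "HOL-Algebra.Ideal"
    "HOL-Library.Disjoint_Sets" "HOL-Library.Poly_Mapping"
begin

section \<open>Polynomial rings on a set of variables\<close>

type_synonym 'v mon = "'v \<Rightarrow>\<^sub>0 nat"
type_synonym ('v, 'k) mpoly = "('v \<Rightarrow>\<^sub>0 nat) \<Rightarrow>\<^sub>0 'k"

text \<open>The set of variables is an explicit set rather than a type: the carrier consists of the
  polynomials in which only variables from \<open>X\<close> occur.\<close>

definition poly_ring :: "'v set \<Rightarrow> ('v, 'k::field) mpoly ring" where
  "poly_ring X = \<lparr>carrier = {p. \<forall>m\<in>Poly_Mapping.keys p. Poly_Mapping.keys m \<subseteq> X},
     monoid.mult = (*), one = 1, ring.zero = 0, add = (+)\<rparr>"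

lemma cring_poly_ring: "cring (poly_ring X :: ('v, 'k::field) mpoly ring)"
proof -
  define C where "C = {p :: ('v, 'k) mpoly. \<forall>m\<in>Poly_Mapping.keys p. Poly_Mapping.keys m \<subseteq> X}"
  have mult: "p * q \<in> C" if "p \<in> C" "q \<in> C" for p q
  proof -
    have "Poly_Mapping.keys m \<subseteq> X" if m: "m \<in> Poly_Mapping.keys (p * q)" for m
    proof -
      obtain a b where "a \<in> Poly_Mapping.keys p" "b \<in> Poly_Mapping.keys q" "m = a + b"
        using keys_mult[of p q] m by blast
      then show ?thesis
        using \<open>p \<in> C\<close> \<open>q \<in> C\<close> keys_add[of a b] unfolding C_def by blast
    qed
    then show ?thesis unfolding C_def by blast
  qed
  have add: "p + q \<in> C" if "p \<in> C" "q \<in> C" for p q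
    using that keys_add[of p q] unfolding C_def by blast
  have zero: "0 \<in> C" and one: "1 \<in> C"
    unfolding C_def by simp_all
  have uminus: "- p \<in> C" if "p \<in> C" for p
    using that unfolding C_def by simp
  have ring: "poly_ring X = \<lparr>carrier = C, monoid.mult = (*), one = 1, ring.zero = 0, add = (+)\<rparr>"
    unfolding poly_ring_def C_def ..
  show ?thesis
    unfolding ring
  proof (intro cringI abelian_groupI comm_monoidI,
      simp_all only: ring.simps monoid.simps partial_object.simps)
    fix p assume "p \<in> C"
    then show "\<exists>q\<in>C. q + p = 0" using uminus by (intro bexI[of _ "- p"]) simp_all
  qed (simp_all add: mult add zero one ac_simps distrib_left distrib_right)
qed

definition x_var :: "'v \<Rightarrow> ('v, 'k::field) mpoly" where
  "x_var v = Poly_Mapping.single (Poly_Mapping.single v 1) 1"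

definition x_mon :: "'v mon \<Rightarrow> ('v, 'k::field) mpoly" where
  "x_mon a = Poly_Mapping.single a 1"

definition mon_dvd :: "'v mon \<Rightarrow> 'v mon \<Rightarrow> bool" where
  "mon_dvd a b \<longleftrightarrow> (\<forall>v. Poly_Mapping.lookup a v \<le> Poly_Mapping.lookup b v)"

section \<open>Monomial ideals\<close>

text \<open>Monomials are represented by their exponents.\<close>

definition monomial_ideal :: "'v set \<Rightarrow> ('v, 'k::field) mpoly set \<Rightarrow> bool" where
  "monomial_ideal X I \<longleftrightarrow>
     (\<exists>S. (\<forall>a\<in>S. Poly_Mapping.keys a \<subseteq> X) \<and> I = Idl\<^bsub>poly_ring X\<^esub> (x_mon ` S))"

definition min_gens :: "('v, 'k::field) mpoly set \<Rightarrow> 'v mon set" where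
  "min_gens I = {a. x_mon a \<in> I \<and> (\<forall>b. x_mon b \<in> I \<and> mon_dvd b a \<longrightarrow> b = a)}"

text \<open>The list \<open>xs\<close> is the order \<open>xs ! 0 > xs ! 1 > \<dots>\<close> of the variables. The hypotheses on \<open>t\<close>
  say that \<open>u\<close> is lexicographically greater than \<open>v\<close> and that \<open>t\<close> is the first position where
  they differ; as \<open>xs ! j\<close> divides \<open>v\<close>, the subtraction is exact.\<close>

definition weakly_polymatroidal_wrt :: "'v list \<Rightarrow> ('v, 'k::field) mpoly set \<Rightarrow> bool" where
  "weakly_polymatroidal_wrt xs I \<longleftrightarrow>
     (\<forall>u\<in>min_gens I. \<forall>v\<in>min_gens I. \<forall>t<length xs.
        (\<forall>i<t. Poly_Mapping.lookup u (xs ! i) = Poly_Mapping.lookup v (xs ! i)) \<and>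
        Poly_Mapping.lookup u (xs ! t) > Poly_Mapping.lookup v (xs ! t) \<longrightarrow>
        (\<exists>j. t < j \<and> j < length xs \<and> Poly_Mapping.lookup v (xs ! j) > 0 \<and>
           Poly_Mapping.single (xs ! t) 1 + (v - Poly_Mapping.single (xs ! j) 1) \<in> min_gens I))"

definition weakly_polymatroidal :: "'v set \<Rightarrow> ('v, 'k::field) mpoly set \<Rightarrow> bool" where
  "weakly_polymatroidal X I \<longleftrightarrow> monomial_ideal X I \<and>
     (\<exists>xs. distinct xs \<and> set xs = X \<and> weakly_polymatroidal_wrt xs I)"

definition colon_ideal ::
  "'v set \<Rightarrow> ('v, 'k::field) mpoly set \<Rightarrow> ('v, 'k) mpoly \<Rightarrow> ('v, 'k) mpoly set" where
  "colon_ideal X I f = {p \<in> carrier (poly_ring X). p * f \<in> I}"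

definition linear_quotients :: "'v set \<Rightarrow> ('v, 'k::field) mpoly set \<Rightarrow> bool" where
  "linear_quotients X I \<longleftrightarrow> monomial_ideal X I \<and>
     (\<exists>ms. distinct ms \<and> set ms = min_gens I \<and>
        (\<forall>j. 1 \<le> j \<and> j < length ms \<longrightarrow>
           (\<exists>Y\<subseteq>X. colon_ideal X (Idl\<^bsub>poly_ring X\<^esub> (x_mon ` set (take j ms))) (x_mon (ms ! j))
              = (Idl\<^bsub>poly_ring X\<^esub> (x_var ` Y) :: ('v, 'k) mpoly set))))"

section \<open>Multigraded free resolutions and homological shift ideals\<close>

definition free_mod :: "'v set \<Rightarrow> nat \<Rightarrow> ('v, 'k::field) mpoly vec set" where
  "free_mod X n = {f \<in> carrier_vec n. \<forall>i<n. f $ i \<in> carrier (poly_ring X)}"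

text \<open>A list \<open>as\<close> of exponents stands for the multigraded free module
  \<open>\<Oplus>\<^sub>j R(-as ! j)\<close>, whose \<open>j\<close>-th basis vector has degree \<open>as ! j\<close>. A matrix represents a
  homomorphism \<open>\<Oplus>\<^sub>j R(-as ! j) \<rightarrow> \<Oplus>\<^sub>i R(-bs ! i)\<close> of multidegree \<open>0\<close> iff its \<open>(i, j)\<close> entry is
  homogeneous of degree \<open>as ! j - bs ! i\<close>, i.e. a scalar multiple of that monomial (and \<open>0\<close> if
  \<open>bs ! i\<close> does not divide \<open>as ! j\<close>).\<close>

definition graded_mat ::
  "'v mon list \<Rightarrow> 'v mon list \<Rightarrow> ('v, 'k::field) mpoly mat \<Rightarrow> bool" where
  "graded_mat as bs A \<longleftrightarrow> A \<in> carrier_mat (length bs) (length as) \<and>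
     (\<forall>i<length bs. \<forall>j<length as. \<forall>m\<in>Poly_Mapping.keys (A $$ (i, j)). bs ! i + m = as ! j)"

text \<open>\<open>sh k\<close> is the list of shifts of \<open>F\<^sub>k\<close>, \<open>d (Suc k)\<close> is the differential \<open>F\<^sub>k\<^sub>+\<^sub>1 \<rightarrow> F\<^sub>k\<close>, and
  \<open>d 0\<close> is the augmentation \<open>F\<^sub>0 \<rightarrow> I \<subseteq> R\<close>, a matrix with a single row. Minimality
  means that the differentials \<open>F\<^sub>k\<^sub>+\<^sub>1 \<rightarrow> F\<^sub>k\<close> have entries without constant term.\<close>

definition minimal_free_resolution ::
  "'v set \<Rightarrow> ('v, 'k::field) mpoly set \<Rightarrow> (nat \<Rightarrow> 'v mon list) \<Rightarrow> (nat \<Rightarrow> ('v, 'k) mpoly mat) \<Rightarrow> bool"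
  where
  "minimal_free_resolution X I sh d \<longleftrightarrow>
     (\<forall>k. \<forall>a\<in>set (sh k). Poly_Mapping.keys a \<subseteq> X) \<and>
     (\<exists>r. \<forall>k>r. sh k = []) \<and>
     graded_mat (sh 0) [0] (d 0) \<and>
     (\<forall>k. graded_mat (sh (Suc k)) (sh k) (d (Suc k))) \<and>
     {(d 0 *\<^sub>v f) $ 0 | f. f \<in> free_mod X (length (sh 0))} = I \<and>
     (\<forall>k. {f \<in> free_mod X (length (sh k)). d k *\<^sub>v f = 0\<^sub>v (dim_row (d k))} =
          {d (Suc k) *\<^sub>v g | g. g \<in> free_mod X (length (sh (Suc k)))}) \<and>
     (\<forall>k. \<forall>i<length (sh k). \<forall>j<length (sh (Suc k)). Poly_Mapping.lookup (d (Suc k) $$ (i, j)) 0 = 0)"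

text \<open>Minimal multigraded free resolutions are unique up to isomorphism, so the shifts do not
  depend on the resolution.\<close>

definition multigraded_shifts :: "'v set \<Rightarrow> ('v, 'k::field) mpoly set \<Rightarrow> nat \<Rightarrow> 'v mon set" where
  "multigraded_shifts X I k = {a. \<exists>sh d. minimal_free_resolution X I sh d \<and> a \<in> set (sh k)}"

definition homological_shift_ideal ::
  "'v set \<Rightarrow> nat \<Rightarrow> ('v, 'k::field) mpoly set \<Rightarrow> ('v, 'k) mpoly set" where
  "homological_shift_ideal X k I = Idl\<^bsub>poly_ring X\<^esub> (x_mon ` multigraded_shifts X I k)"

section \<open>Graphs\<close>

definition complete_edges :: "'v set \<Rightarrow> 'v set set" where
  "complete_edges V = {{u, v} | u v. u \<in> V \<and> v \<in> V \<and> u \<noteq> v}"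

definition simple_graph :: "'v set \<Rightarrow> 'v set set \<Rightarrow> bool" where
  "simple_graph V E \<longleftrightarrow> finite V \<and> E \<subseteq> complete_edges V"

definition vertex_cover :: "'v set \<Rightarrow> 'v set set \<Rightarrow> 'v set \<Rightarrow> bool" where
  "vertex_cover V E C \<longleftrightarrow> C \<subseteq> V \<and> (\<forall>e\<in>E. C \<inter> e \<noteq> {})"

definition minimal_vertex_cover :: "'v set \<Rightarrow> 'v set set \<Rightarrow> 'v set \<Rightarrow> bool" where
  "minimal_vertex_cover V E C \<longleftrightarrow> vertex_cover V E C \<and> (\<forall>D\<subset>C. \<not> vertex_cover V E D)"

definition vertex_cover_ideal :: "'v set \<Rightarrow> 'v set set \<Rightarrow> ('v, 'k::field) mpoly set" where
  "vertex_cover_ideal V E =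
     Idl\<^bsub>poly_ring V\<^esub> {\<Prod>v\<in>C. x_var v | C. minimal_vertex_cover V E C}"

text \<open>In the clique corona, \<open>w i\<close> is the \<open>i\<close>-th vertex of \<open>\<Gamma> = (V, E)\<close> and \<open>T i\<close> is the vertex
  set of the \<open>i\<close>-th complete graph.\<close>

definition corona_verts :: "'v set \<Rightarrow> nat \<Rightarrow> (nat \<Rightarrow> 'v set) \<Rightarrow> 'v set" where
  "corona_verts V n T = V \<union> (\<Union>i\<in>{1..n}. T i)"

definition corona_edges ::
  "'v set set \<Rightarrow> nat \<Rightarrow> (nat \<Rightarrow> 'v) \<Rightarrow> (nat \<Rightarrow> 'v set) \<Rightarrow> 'v set set" where
  "corona_edges E n w T =
     E \<union> (\<Union>i\<in>{1..n}. complete_edges (T i)) \<union> (\<Union>i\<in>{1..n}. {{w i, x} | x. x \<in> T i})"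

end

theory Submission
  imports Defs "HOL-Library.List_Lexorder"
begin

text \<open>Call a set of vertices independent if it contains no edge. A monomial \<open>x\<^sup>a\<close> lies in \<open>J\<close> iff the
  vertices outside its support are independent, and every independent set has at most one vertex in
  each of the \<open>n\<close> cliques \<open>{w i} \<union> T i\<close>. In any minimal multigraded resolution of \<open>J\<close> the shifts in
  homological degree \<open>k\<close> are exactly the squarefree monomials whose complementary set of vertices
  is independent with \<open>n - k\<close> elements.

  To see this, consider for a degree \<open>a\<close> and a set \<open>S\<close> of variables the subquotient of the resolution
  spanned by the basis elements whose degrees divide \<open>a\<close> and agree with \<open>a\<close> on \<open>S\<close>. For \<open>S = {}\<close> its
  homology is the degree \<open>a\<close> part of \<open>J\<close>, and for the set \<open>S\<close> of all variables minimality makes its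
  differential vanish, so that its homology counts the shifts equal to \<open>a\<close>. Adding \<open>v\<close> to \<open>S\<close> gives a
  short exact sequence with the subquotients for \<open>(a / v, S)\<close>, \<open>(a, S)\<close> and \<open>(a, S \<union> {v})\<close>. If the
  variables are added in a suitable order, beginning with one vertex of each \<open>T i\<close>, the homology stays
  concentrated in one degree; it is nonzero because each \<open>T i\<close> has a second vertex.

  The exchange property of independent sets of equal size holds for any order of the variables that
  puts the vertices of \<open>\<Gamma>\<close> first, and listing the generators in decreasing lexicographic order yields
  linear quotients.\<close>

section \<open>Exactness for subcomplexes and quotient complexes\<close>

text \<open>\<open>c k\<close> is the matrix of a map from level \<open>k + 1\<close>, with basis \<open>B (k + 1)\<close>, to level \<open>k\<close>. Exactness at \<open>k\<close>
  refers to level \<open>k + 1\<close>, so that nothing is required at level \<open>0\<close>.\<close>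

definition exact_at :: "(nat \<Rightarrow> 'i \<Rightarrow> 'i \<Rightarrow> 'k::field) \<Rightarrow> (nat \<Rightarrow> 'i set) \<Rightarrow> nat \<Rightarrow> bool" where
  "exact_at c B k \<longleftrightarrow> (\<forall>g. (\<forall>i\<in>B k. (\<Sum>j\<in>B (Suc k). c k i j * g j) = 0) \<longrightarrow>
     (\<exists>h. \<forall>i\<in>B (Suc k). g i = (\<Sum>j\<in>B (Suc (Suc k)). c (Suc k) i j * h j)))"

lemma exact_atD:
  assumes "exact_at c B k" "\<And>i. i \<in> B k \<Longrightarrow> (\<Sum>j\<in>B (Suc k). c k i j * g j) = 0"
  shows "\<exists>h. \<forall>i\<in>B (Suc k). g i = (\<Sum>j\<in>B (Suc (Suc k)). c (Suc k) i j * h j)"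
  using assms unfolding exact_at_def by blast

text \<open>\<open>L\<close> spans a subcomplex and \<open>U\<close> the quotient by it. The lemmas on exactness below are the parts of
  the long exact homology sequence that speak about vanishing only.\<close>

locale chain_split =
  fixes c :: "nat \<Rightarrow> 'i \<Rightarrow> 'i \<Rightarrow> 'k::field" and L U :: "nat \<Rightarrow> 'i set"
  assumes finite_L: "finite (L k)" and finite_U: "finite (U k)"
    and disjoint: "L k \<inter> U k = {}"
    and closed: "i \<in> U k \<Longrightarrow> j \<in> L (Suc k) \<Longrightarrow> c k i j = 0"
    and dd: "i \<in> L k \<union> U k \<Longrightarrow> j \<in> L (Suc (Suc k)) \<union> U (Suc (Suc k)) \<Longrightarrow>
      (\<Sum>m\<in>L (Suc k) \<union> U (Suc k). c k i m * c (Suc k) m j) = 0"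
begin

abbreviation "B k \<equiv> L k \<union> U k"

lemma sum_B: "(\<Sum>j\<in>B k. f j) = (\<Sum>j\<in>L k. f j) + (\<Sum>j\<in>U k. f j)"
  by (rule sum.union_disjoint[OF finite_L finite_U disjoint])

lemma not_both: "i \<in> U k \<Longrightarrow> i \<notin> L k"
  using disjoint by blast

lemma sum_closed: "i \<in> U k \<Longrightarrow> (\<Sum>j\<in>L (Suc k). c k i j * f j) = 0"
  by (rule sum.neutral) (simp add: closed)

lemma sum_L_ext:
  fixes a f :: "'i \<Rightarrow> 'k"
  shows "(\<Sum>j\<in>L k. a j * (if j \<in> L k then f j else 0)) = (\<Sum>j\<in>L k. a j * f j)"
  "(\<Sum>j\<in>U k. a j * (if j \<in> L k then f j else 0)) = 0"
  by (rule sum.cong, simp, simp) (rule sum.neutral, use disjoint in auto)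

lemma sum_U_ext:
  fixes a f :: "'i \<Rightarrow> 'k"
  shows "(\<Sum>j\<in>U k. a j * (if j \<in> U k then f j else 0)) = (\<Sum>j\<in>U k. a j * f j)"
  "(\<Sum>j\<in>L k. a j * (if j \<in> U k then f j else 0)) = 0"
  by (rule sum.cong, simp, simp) (rule sum.neutral, use disjoint in auto)

lemma boundary_boundary:
  assumes "i \<in> B k"
  shows "(\<Sum>m\<in>B (Suc k). c k i m * (\<Sum>j\<in>B (Suc (Suc k)). c (Suc k) m j * h j)) = 0"
proof -
  have "(\<Sum>m\<in>B (Suc k). c k i m * (\<Sum>j\<in>B (Suc (Suc k)). c (Suc k) m j * h j))
      = (\<Sum>j\<in>B (Suc (Suc k)). (\<Sum>m\<in>B (Suc k). c k i m * c (Suc k) m j) * h j)"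
    unfolding sum_distrib_left sum_distrib_right mult.assoc[symmetric] by (rule sum.swap)
  also have "\<dots> = 0"
    using dd[OF assms] by simp
  finally show ?thesis .
qed

text \<open>The image of a cycle in the quotient bounds some \<open>h\<close>. Subtracting the
  boundary of \<open>h\<close>, extended by zero, leaves a cycle supported on \<open>L\<close>,
  which bounds by exactness of the subcomplex.\<close>

lemma exact_total:
  assumes "exact_at c L k" "exact_at c U k"
  shows "exact_at c B k"
  unfolding exact_at_def
proof (intro allI impI)
  fix g assume g: "\<forall>i\<in>B k. (\<Sum>j\<in>B (Suc k). c k i j * g j) = 0"
  have "(\<Sum>j\<in>U (Suc k). c k i j * g j) = 0" if "i \<in> U k" for i
    using g[rule_format, of i] that sum_closed[OF that, of g] by (simp add: sum_B)
  from exact_atD[OF assms(2) this]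
  obtain h where h: "\<And>i. i \<in> U (Suc k) \<Longrightarrow> g i = (\<Sum>j\<in>U (Suc (Suc k)). c (Suc k) i j * h j)"
    by blast
  define h' where "h' j = (if j \<in> U (Suc (Suc k)) then h j else 0)" for j
  define f where "f i = g i - (\<Sum>j\<in>B (Suc (Suc k)). c (Suc k) i j * h' j)" for i
  have f_U: "f i = 0" if "i \<in> U (Suc k)" for i
    unfolding f_def sum_B h'_def using h[OF that] by (simp add: sum_U_ext)
  have "(\<Sum>j\<in>L (Suc k). c k i j * f j) = 0" if "i \<in> L k" for i
  proof -
    have "(\<Sum>j\<in>L (Suc k). c k i j * f j) = (\<Sum>j\<in>B (Suc k). c k i j * f j)"
      by (simp add: sum_B f_U)
    also have "\<dots> = (\<Sum>j\<in>B (Suc k). c k i j * g j)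
        - (\<Sum>j\<in>B (Suc k). c k i j * (\<Sum>l\<in>B (Suc (Suc k)). c (Suc k) j l * h' l))"
      by (simp add: f_def right_diff_distrib sum_subtractf)
    also have "\<dots> = 0"
      using g that boundary_boundary[of i k h'] by simp
    finally show ?thesis .
  qed
  from exact_atD[OF assms(1) this]
  obtain e where e: "\<And>i. i \<in> L (Suc k) \<Longrightarrow> f i = (\<Sum>j\<in>L (Suc (Suc k)). c (Suc k) i j * e j)"
    by blast
  define e' where "e' j = (if j \<in> L (Suc (Suc k)) then e j else 0)" for j
  have "f i = (\<Sum>j\<in>B (Suc (Suc k)). c (Suc k) i j * e' j)" if "i \<in> B (Suc k)" for i
    using that
  proof
    assume i: "i \<in> L (Suc k)"
    show ?thesis
      unfolding sum_B e'_def sum_L_ext using e[rule_format, OF i] by simp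
  next
    assume i: "i \<in> U (Suc k)"
    show ?thesis
      unfolding sum_B sum_closed[OF i] f_U[OF i] e'_def sum_L_ext by simp
  qed
  note f_e = this
  have *: "g i = (\<Sum>j\<in>B (Suc (Suc k)). c (Suc k) i j * h' j) +
      (\<Sum>j\<in>B (Suc (Suc k)). c (Suc k) i j * e' j)" if "i \<in> B (Suc k)" for i
    using f_e[OF that] unfolding f_def by (simp only: diff_eq_eq add.commute)
  have "g i = (\<Sum>j\<in>B (Suc (Suc k)). c (Suc k) i j * (h' j + e' j))" if "i \<in> B (Suc k)" for i
    unfolding distrib_left sum.distrib by (rule *[OF that])
  then show "\<exists>h. \<forall>i\<in>B (Suc k). g i = (\<Sum>j\<in>B (Suc (Suc k)). c (Suc k) i j * h j)"
    by (intro exI[of _ "\<lambda>j. h' j + e' j"] ballI)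
qed

text \<open>A cycle of the quotient, extended by zero, has its boundary \<open>f\<close> in
  \<open>L\<close>, and \<open>f\<close> is again a cycle. Once \<open>f\<close> bounds inside
  \<open>L\<close>, a correction by a chain of \<open>L\<close> gives a cycle of the whole complex.
  Below level \<open>0\<close> there is no differential that could express being a cycle, so for
  \<open>k = 0\<close> surjectivity onto \<open>L 0\<close> is assumed instead.\<close>

lemma exact_quotient:
  assumes "exact_at c B k"
    and zero: "\<And>f. k = 0 \<Longrightarrow> \<exists>h. \<forall>i\<in>L 0. f i = (\<Sum>j\<in>L 1. c 0 i j * h j)"
    and Suc: "\<And>k'. k = Suc k' \<Longrightarrow> exact_at c L k'"
  shows "exact_at c U k"
  unfolding exact_at_def
proof (intro allI impI)
  fix g assume g: "\<forall>i\<in>U k. (\<Sum>j\<in>U (Suc k). c k i j * g j) = 0"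
  define g' where "g' j = (if j \<in> U (Suc k) then g j else 0)" for j
  define f where "f i = (\<Sum>j\<in>B (Suc k). c k i j * g' j)" for i
  have f_U: "f i = 0" if "i \<in> U k" for i
    unfolding f_def sum_B g'_def using g that by (simp add: sum_U_ext)
  have "\<exists>h. \<forall>i\<in>L k. f i = (\<Sum>j\<in>L (Suc k). c k i j * h j)"
  proof (cases k)
    case 0
    then show ?thesis using zero by simp
  next
    case k: (Suc k')
    have "(\<Sum>m\<in>L (Suc k'). c k' i m * f m) = 0" if "i \<in> L k'" for i
    proof -
      have "(\<Sum>m\<in>L (Suc k'). c k' i m * f m) = (\<Sum>m\<in>B (Suc k'). c k' i m * f m)"
        using f_U k by (simp add: sum_B)
      also have "\<dots> = 0"
        unfolding f_def k using that by (intro boundary_boundary) simp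
      finally show ?thesis .
    qed
    from exact_atD[OF Suc[OF k] this] show ?thesis
      unfolding k .
  qed
  then obtain h where h: "\<And>i. i \<in> L k \<Longrightarrow> f i = (\<Sum>j\<in>L (Suc k). c k i j * h j)"
    by blast
  define h' where "h' j = (if j \<in> L (Suc k) then h j else 0)" for j
  have "(\<Sum>j\<in>B (Suc k). c k i j * (g' j - h' j)) = 0" if i: "i \<in> B k" for i
  proof -
    have "(\<Sum>j\<in>B (Suc k). c k i j * h' j) = f i"
      using i
    proof
      assume i: "i \<in> L k"
      show ?thesis
        unfolding sum_B h'_def sum_L_ext using h[OF i] by simp
    next
      assume i: "i \<in> U k"
      show ?thesis
        unfolding sum_B sum_closed[OF i] f_U[OF i] h'_def sum_L_ext by simp
    qed
    then show ?thesis
      by (simp add: right_diff_distrib sum_subtractf f_def)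
  qed
  from exact_atD[OF assms(1) this]
  obtain e where
    e: "\<And>i. i \<in> B (Suc k) \<Longrightarrow> g' i - h' i = (\<Sum>j\<in>B (Suc (Suc k)). c (Suc k) i j * e j)"
    by blast
  have "g i = (\<Sum>j\<in>U (Suc (Suc k)). c (Suc k) i j * e j)" if i: "i \<in> U (Suc k)" for i
    using e[of i] i not_both[OF i] sum_closed[OF i] unfolding sum_B g'_def h'_def by simp
  then show "\<exists>h. \<forall>i\<in>U (Suc k). g i = (\<Sum>j\<in>U (Suc (Suc k)). c (Suc k) i j * h j)"
    by blast
qed

text \<open>A cycle of \<open>L\<close> is the boundary of some \<open>h\<close> in the whole
  complex. The part of \<open>h\<close> on \<open>U\<close> is a cycle of the quotient one level
  higher; subtracting a boundary from \<open>h\<close> removes it without changing the boundary of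
  \<open>h\<close>.\<close>

lemma exact_sub:
  assumes "exact_at c U (Suc k)" "exact_at c B k"
  shows "exact_at c L k"
  unfolding exact_at_def
proof (intro allI impI)
  fix g assume g: "\<forall>i\<in>L k. (\<Sum>j\<in>L (Suc k). c k i j * g j) = 0"
  define g' where "g' j = (if j \<in> L (Suc k) then g j else 0)" for j
  have "(\<Sum>j\<in>B (Suc k). c k i j * g' j) = 0" if "i \<in> B k" for i
    using that
  proof
    assume "i \<in> L k"
    then show ?thesis
      unfolding sum_B g'_def sum_L_ext using g by simp
  next
    assume i: "i \<in> U k"
    show ?thesis
      unfolding sum_B sum_closed[OF i] g'_def sum_L_ext by simp
  qed
  from exact_atD[OF assms(2) this]
  obtain h where h: "\<And>i. i \<in> B (Suc k) \<Longrightarrow> g' i = (\<Sum>j\<in>B (Suc (Suc k)). c (Suc k) i j * h j)"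
    by blast
  have "(\<Sum>j\<in>U (Suc (Suc k)). c (Suc k) i j * h j) = 0" if i: "i \<in> U (Suc k)" for i
    using h[of i] i not_both[OF i] sum_closed[OF i] by (simp add: sum_B g'_def)
  from exact_atD[OF assms(1) this]
  obtain e where
    e: "\<And>i. i \<in> U (Suc (Suc k)) \<Longrightarrow> h i = (\<Sum>j\<in>U (Suc (Suc (Suc k))). c (Suc (Suc k)) i j * e j)"
    by blast
  define e' where "e' j = (if j \<in> U (Suc (Suc (Suc k))) then e j else 0)" for j
  define f where "f i = h i - (\<Sum>j\<in>B (Suc (Suc (Suc k))). c (Suc (Suc k)) i j * e' j)" for i
  have f_U: "f i = 0" if "i \<in> U (Suc (Suc k))" for i
    unfolding f_def sum_B e'_def using e[OF that] by (simp add: sum_U_ext)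
  have "g i = (\<Sum>j\<in>L (Suc (Suc k)). c (Suc k) i j * f j)" if i: "i \<in> L (Suc k)" for i
  proof -
    have "(\<Sum>j\<in>L (Suc (Suc k)). c (Suc k) i j * f j) = (\<Sum>j\<in>B (Suc (Suc k)). c (Suc k) i j * f j)"
      by (simp add: sum_B f_U)
    also have "\<dots> = (\<Sum>j\<in>B (Suc (Suc k)). c (Suc k) i j * h j) - (\<Sum>j\<in>B (Suc (Suc k)). c (Suc k) i j *
        (\<Sum>l\<in>B (Suc (Suc (Suc k))). c (Suc (Suc k)) j l * e' l))"
      by (simp add: f_def right_diff_distrib sum_subtractf)
    also have "\<dots> = g' i"
      using h[of i] i boundary_boundary[of i "Suc k" e'] by simp
    finally show ?thesis
      using i by (simp add: g'_def)
  qed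
  then show "\<exists>h. \<forall>i\<in>L (Suc k). g i = (\<Sum>j\<in>L (Suc (Suc k)). c (Suc k) i j * h j)"
    by blast
qed

end

section \<open>Monomial ideals\<close>

lemma lookup_single_if: "Poly_Mapping.lookup (Poly_Mapping.single a b) x = (if x = a then b else 0)"
  by (simp add: lookup_single)

lemma mon_dvd_refl [simp]: "mon_dvd a a"
  by (simp add: mon_dvd_def)

lemma mon_dvd_trans: "mon_dvd a b \<Longrightarrow> mon_dvd b c \<Longrightarrow> mon_dvd a c"
  unfolding mon_dvd_def using le_trans by blast

lemma mon_dvd_antisym: "mon_dvd a b \<Longrightarrow> mon_dvd b a \<Longrightarrow> a = b"
  unfolding mon_dvd_def by (intro poly_mapping_eqI) (simp add: dual_order.antisym)

lemma mon_dvd_diff: "mon_dvd a b \<Longrightarrow> a + (b - a) = b"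
  by (intro poly_mapping_eqI) (simp add: mon_dvd_def lookup_add lookup_minus)

lemma mon_dvd_add: "mon_dvd a (a + b)"
  by (simp add: mon_dvd_def lookup_add)

lemma mon_dvd_zero [simp]: "mon_dvd 0 a"
  by (simp add: mon_dvd_def)

lemma keys_mon_dvd: "mon_dvd a b \<Longrightarrow> Poly_Mapping.keys a \<subseteq> Poly_Mapping.keys b"
  unfolding mon_dvd_def by (metis in_keys_iff le_zero_eq subsetI)

lemma keys_diff_mon: "Poly_Mapping.keys (a - b :: 'v mon) \<subseteq> Poly_Mapping.keys a"
  by (auto simp: in_keys_iff lookup_minus)

lemma keys_add_mon: "Poly_Mapping.keys (a + b :: 'v mon) = Poly_Mapping.keys a \<union> Poly_Mapping.keys b"
  by (auto simp: in_keys_iff lookup_add)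

lemma lookup_single_times:
  fixes h :: "('v, 'k::field) mpoly"
  shows "Poly_Mapping.lookup (Poly_Mapping.single m c * h) (m + m') = c * Poly_Mapping.lookup h m'"
    (is ?thesis1)
    and "\<not> mon_dvd m b \<Longrightarrow> Poly_Mapping.lookup (Poly_Mapping.single m c * h) b = 0"
proof -
  have *: "Poly_Mapping.lookup (Poly_Mapping.single m c * h) b =
      (\<Sum>l. (if l = m then c else 0) * (\<Sum>q. Poly_Mapping.lookup h q when b = l + q))" for b
    unfolding lookup_mult lookup_single_if ..
  have **: "Poly_Mapping.lookup (Poly_Mapping.single m c * h) b =
      c * (\<Sum>q. Poly_Mapping.lookup h q when b = m + q)" for b
  proof -
    have "(\<lambda>l. (if l = m then c else 0) * (\<Sum>q. Poly_Mapping.lookup h q when b = l + q)) =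
      (\<lambda>l. (c * (\<Sum>q. Poly_Mapping.lookup h q when b = m + q)) when l = m)"
      by (auto simp: when_def)
    note eq = this
    show ?thesis
      unfolding * eq by simp
  qed
  have "(\<lambda>q. Poly_Mapping.lookup h q when m + m' = m + q) = (\<lambda>q. Poly_Mapping.lookup h q when q = m')"
    by (auto simp: when_def)
  note eq = this
  show ?thesis1
    unfolding ** eq by simp
  show "Poly_Mapping.lookup (Poly_Mapping.single m c * h) b = 0" if "\<not> mon_dvd m b"
  proof -
    have "(\<lambda>q. Poly_Mapping.lookup h q when b = m + q) = (\<lambda>q. 0)"
      using that mon_dvd_add[of m] by (auto simp: when_def fun_eq_iff)
    note eq = this
    show ?thesis
      unfolding ** eq by simp
  qed
qed

lemma poly_ring_simps [simp]:
  "monoid.mult (poly_ring X) = (*)" "one (poly_ring X) = 1"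
  "ring.zero (poly_ring X) = 0" "add (poly_ring X) = (+)"
  by (simp_all add: poly_ring_def)

lemma carrier_poly_ring:
  "p \<in> carrier (poly_ring X) \<longleftrightarrow> (\<forall>m\<in>Poly_Mapping.keys p. Poly_Mapping.keys m \<subseteq> X)"
  by (simp add: poly_ring_def)

lemma single_in_carrier: "Poly_Mapping.keys m \<subseteq> X \<Longrightarrow> Poly_Mapping.single m c \<in> carrier (poly_ring X)"
  by (simp add: carrier_poly_ring)

lemma x_mon_mult: "x_mon a * x_mon b = x_mon (a + b)"
  by (simp add: x_mon_def mult_single)

text \<open>Every monomial of a product is a multiple of a monomial of either factor, so an upward
  closed condition on exponents survives multiplication by arbitrary polynomials.\<close>

lemma ideal_monomials:
  fixes P :: "'v mon \<Rightarrow> bool"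
  assumes up: "\<And>a b. P a \<Longrightarrow> P (a + b)"
  shows "ideal {p \<in> carrier (poly_ring X :: ('v, 'k::field) mpoly ring). \<forall>m\<in>Poly_Mapping.keys p. P m}
    (poly_ring X)" (is "ideal ?I ?R")
proof -
  interpret cring ?R by (rule cring_poly_ring)
  have neg: "a_inv ?R p = - p" if "p \<in> carrier ?R" for p
    using that by (intro minus_equality) (auto simp: carrier_poly_ring)
  have mult: "p * q \<in> ?I" if p: "p \<in> ?I" and q: "q \<in> carrier ?R" for p q
  proof -
    have "P m" if "m \<in> Poly_Mapping.keys (p * q)" for m
      using keys_mult[of p q] that p up by blast
    then show ?thesis
      using p m_closed[of p q] q by simp
  qed
  have zero: "0 \<in> ?I"
    using zero_closed by simp
  show ?thesis
  proof (rule idealI)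
    show "ring ?R" by (rule ring_axioms)
    show "subgroup ?I (add_monoid ?R)"
    proof
      show "?I \<subseteq> carrier (add_monoid ?R)" "\<one>\<^bsub>add_monoid ?R\<^esub> \<in> ?I"
        using zero by auto
      show "p \<otimes>\<^bsub>add_monoid ?R\<^esub> q \<in> ?I" if "p \<in> ?I" "q \<in> ?I" for p q
        using that keys_add[of p q] add.m_closed[of p q] by (auto simp del: add.m_closed)
      show "inv\<^bsub>add_monoid ?R\<^esub> p \<in> ?I" if "p \<in> ?I" for p
        using that neg[of p] add.inv_closed[of p] by (simp add: a_inv_def)
    qed
  next
    show "x \<otimes>\<^bsub>?R\<^esub> p \<in> ?I" "p \<otimes>\<^bsub>?R\<^esub> x \<in> ?I" if "p \<in> ?I" "x \<in> carrier ?R" for p x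
      using mult[OF that] by (simp_all add: mult.commute)
  qed
qed

lemma sum_singles: "(\<Sum>m\<in>Poly_Mapping.keys p. Poly_Mapping.single m (Poly_Mapping.lookup p m)) = p"
  by (intro poly_mapping_eqI)
    (simp add: lookup_sum lookup_single when_def in_keys_iff)

text \<open>The right-hand side is an ideal containing the generators. Conversely a polynomial is
  the sum of its terms, and each term here is a multiple of some generator.\<close>

theorem mem_Idl_monomials:
  fixes p :: "('v, 'k::field) mpoly"
  assumes S: "\<And>a. a \<in> S \<Longrightarrow> Poly_Mapping.keys a \<subseteq> X"
  shows "p \<in> Idl\<^bsub>poly_ring X\<^esub> (x_mon ` S) \<longleftrightarrow>
    p \<in> carrier (poly_ring X) \<and> (\<forall>m\<in>Poly_Mapping.keys p. \<exists>s\<in>S. mon_dvd s m)"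
proof -
  let ?R = "poly_ring X :: ('v, 'k) mpoly ring"
  let ?I = "{p \<in> carrier ?R. \<forall>m\<in>Poly_Mapping.keys p. \<exists>s\<in>S. mon_dvd s m}"
  interpret cring ?R by (rule cring_poly_ring)
  have S': "x_mon ` S \<subseteq> carrier ?R"
    using S by (auto simp: x_mon_def single_in_carrier)
  interpret Idl: ideal "Idl\<^bsub>?R\<^esub> (x_mon ` S)" ?R
    by (rule genideal_ideal[OF S'])
  have "ideal ?I ?R"
    by (rule ideal_monomials) (meson mon_dvd_add mon_dvd_trans)
  moreover have "x_mon ` S \<subseteq> ?I"
  proof (rule image_subsetI)
    fix a assume "a \<in> S"
    then show "x_mon a \<in> ?I"
      using S' by (auto simp: x_mon_def intro!: bexI[of _ a])
  qed
  ultimately have "Idl\<^bsub>?R\<^esub> (x_mon ` S) \<subseteq> ?I"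
    by (rule genideal_minimal)
  moreover have "p \<in> Idl\<^bsub>?R\<^esub> (x_mon ` S)" if p: "p \<in> ?I" for p
  proof -
    have single: "Poly_Mapping.single m c \<in> Idl\<^bsub>?R\<^esub> (x_mon ` S)" if m: "m \<in> Poly_Mapping.keys p" for m c
    proof -
      obtain s where s: "s \<in> S" "mon_dvd s m" using p m by blast
      have "Poly_Mapping.keys m \<subseteq> X" using p m by (simp add: carrier_poly_ring)
      then have "Poly_Mapping.single (m - s) c \<in> carrier ?R"
        using keys_diff_mon[of m s] by (intro single_in_carrier) blast
      moreover have "x_mon s \<in> Idl\<^bsub>?R\<^esub> (x_mon ` S)"
        using genideal_self[OF S'] s by blast
      ultimately have "x_mon s * Poly_Mapping.single (m - s) c \<in> Idl\<^bsub>?R\<^esub> (x_mon ` S)"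
        using Idl.I_r_closed by fastforce
      then show ?thesis
        using mon_dvd_diff[OF s(2)] by (simp add: x_mon_def mult_single)
    qed
    have "(\<Sum>m\<in>K. Poly_Mapping.single m (Poly_Mapping.lookup p m)) \<in> Idl\<^bsub>?R\<^esub> (x_mon ` S)"
      if "finite K" "K \<subseteq> Poly_Mapping.keys p" for K
      using that
    proof induction
      case empty
      show ?case using Idl.zero_closed by simp
    next
      case (insert m K)
      then show ?case using Idl.a_closed[OF single] by simp
    qed
    from this[OF finite_keys order_refl] show ?thesis
      unfolding sum_singles .
  qed
  ultimately show ?thesis by blast
qed

corollary x_mon_mem_Idl:
  assumes "\<And>a. a \<in> S \<Longrightarrow> Poly_Mapping.keys a \<subseteq> X"
  shows "(x_mon m :: ('v, 'k::field) mpoly) \<in> Idl\<^bsub>poly_ring X\<^esub> (x_mon ` S) \<longleftrightarrow>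
    Poly_Mapping.keys m \<subseteq> X \<and> (\<exists>s\<in>S. mon_dvd s m)"
  by (subst mem_Idl_monomials[OF assms]) (simp_all add: x_mon_def carrier_poly_ring)

section \<open>Multigraded strands of a resolution\<close>

locale graded_resolution =
  fixes X :: "'v set" and I :: "('v, 'k::field) mpoly set"
    and sh :: "nat \<Rightarrow> 'v mon list" and d :: "nat \<Rightarrow> ('v, 'k) mpoly mat"
  assumes resolution: "minimal_free_resolution X I sh d"
    and ideal: "ideal I (poly_ring X)"
begin

text \<open>Level \<open>k + 1\<close> of the augmented resolution has the basis labelled by \<open>sh k\<close>; level \<open>0\<close> is the ring
  itself.\<close>

definition rows :: "nat \<Rightarrow> 'v mon list" where
  "rows k = (case k of 0 \<Rightarrow> [0] | Suc k \<Rightarrow> sh k)"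

lemma rows_simps [simp]: "rows 0 = [0]" "rows (Suc k) = sh k"
  by (simp_all add: rows_def)

text \<open>A homogeneous entry is determined by this scalar. If \<open>rows k ! i\<close> does not
  divide \<open>sh k ! j\<close>, the subtraction is truncated, but then the entry and the scalar
  are both \<open>0\<close>.\<close>

definition coef :: "nat \<Rightarrow> nat \<Rightarrow> nat \<Rightarrow> 'k" where
  "coef k i j = Poly_Mapping.lookup (d k $$ (i, j)) (sh k ! j - rows k ! i)"

lemma graded: "graded_mat (sh k) (rows k) (d k)"
  using resolution by (cases k) (auto simp: minimal_free_resolution_def)

lemma d_carrier: "d k \<in> carrier_mat (length (rows k)) (length (sh k))"
  using graded by (simp add: graded_mat_def)

lemma keys_sh: "j < length (sh k) \<Longrightarrow> Poly_Mapping.keys (sh k ! j) \<subseteq> X"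
proof -
  assume "j < length (sh k)"
  moreover have "\<forall>k. \<forall>a\<in>set (sh k). Poly_Mapping.keys a \<subseteq> X"
    using resolution unfolding minimal_free_resolution_def by (rule conjunct1)
  ultimately show ?thesis
    using nth_mem by blast
qed

lemma entry:
  assumes "i < length (rows k)" "j < length (sh k)"
  shows entry_eq: "d k $$ (i, j) = Poly_Mapping.single (sh k ! j - rows k ! i) (coef k i j)"
    and coef_dvd: "coef k i j \<noteq> 0 \<Longrightarrow> mon_dvd (rows k ! i) (sh k ! j)"
proof -
  have *: "rows k ! i + m = sh k ! j" if "m \<in> Poly_Mapping.keys (d k $$ (i, j))" for m
    using graded assms that by (auto simp: graded_mat_def)
  have **: "m = sh k ! j - rows k ! i" if "m \<in> Poly_Mapping.keys (d k $$ (i, j))" for m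
    using *[OF that] by (metis add_diff_cancel_left')
  show "d k $$ (i, j) = Poly_Mapping.single (sh k ! j - rows k ! i) (coef k i j)"
  proof (rule poly_mapping_eqI)
    fix m
    show "Poly_Mapping.lookup (d k $$ (i, j)) m =
        Poly_Mapping.lookup (Poly_Mapping.single (sh k ! j - rows k ! i) (coef k i j)) m"
      using **[of m] by (auto simp: lookup_single_if coef_def in_keys_iff)
  qed
  show "mon_dvd (rows k ! i) (sh k ! j)" if "coef k i j \<noteq> 0"
    using *[of "sh k ! j - rows k ! i"] that mon_dvd_add[of "rows k ! i" "sh k ! j - rows k ! i"]
    by (simp add: coef_def in_keys_iff)
qed

section \<open>Resolutions in a fixed multidegree\<close>

definition below :: "nat \<Rightarrow> 'v mon \<Rightarrow> nat set" where
  "below k a = {j. j < length (sh k) \<and> mon_dvd (sh k ! j) a}"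

lemma finite_below [simp]: "finite (below k a)"
  by (simp add: below_def)

text \<open>The homogeneous element of degree \<open>a\<close> with coordinates \<open>g\<close>:
  the degree \<open>a\<close> part of the \<open>k\<close>-th module has one basis element for each
  \<open>j\<close> in \<open>below k a\<close>, namely the \<open>j\<close>-th basis vector times
  the monomial \<open>a - sh k ! j\<close>.\<close>

definition strand :: "nat \<Rightarrow> 'v mon \<Rightarrow> (nat \<Rightarrow> 'k) \<Rightarrow> ('v, 'k) mpoly vec" where
  "strand k a g = vec (length (sh k)) (\<lambda>j. if j \<in> below k a then
     Poly_Mapping.single (a - sh k ! j) (g j) else 0)"

lemma strand_free: "Poly_Mapping.keys a \<subseteq> X \<Longrightarrow> strand k a g \<in> free_mod X (length (sh k))"
  using keys_diff_mon by (fastforce simp: free_mod_def strand_def carrier_poly_ring)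

lemma lookup_strand: "j \<in> below k a \<Longrightarrow> Poly_Mapping.lookup (strand k a g $ j) (a - sh k ! j) = g j"
  by (simp add: strand_def below_def)

lemma apply_d:
  assumes "i < length (rows k)" "f \<in> free_mod X (length (sh k))"
  shows "(d k *\<^sub>v f) $ i = (\<Sum>j<length (sh k). d k $$ (i, j) * f $ j)"
proof -
  have f: "dim_vec f = length (sh k)"
    using assms(2) by (simp add: free_mod_def)
  show ?thesis
    using assms(1) d_carrier[of k] by (simp add: scalar_prod_def f atLeast0LessThan)
qed

text \<open>In degree \<open>a\<close> the differential is the scalar matrix \<open>coef\<close>,
  since the exponents telescope wherever a coefficient is nonzero.\<close>

lemma apply_strand:
  assumes "i < length (rows k)" "Poly_Mapping.keys a \<subseteq> X"
  shows "(d k *\<^sub>v strand k a g) $ i =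
    Poly_Mapping.single (a - rows k ! i) (\<Sum>j\<in>below k a. coef k i j * g j)"
proof -
  have "(d k *\<^sub>v strand k a g) $ i = (\<Sum>j<length (sh k). d k $$ (i, j) * strand k a g $ j)"
    using assms by (simp add: apply_d strand_free)
  also have "\<dots> = (\<Sum>j\<in>below k a. d k $$ (i, j) * strand k a g $ j)"
    by (rule sum.mono_neutral_right) (auto simp: strand_def below_def)
  also have "\<dots> = (\<Sum>j\<in>below k a. Poly_Mapping.single (a - rows k ! i) (coef k i j * g j))"
  proof (rule sum.cong)
    fix j assume j: "j \<in> below k a"
    then have j': "j < length (sh k)" "mon_dvd (sh k ! j) a" by (auto simp: below_def)
    have "d k $$ (i, j) * strand k a g $ j =
        Poly_Mapping.single ((sh k ! j - rows k ! i) + (a - sh k ! j)) (coef k i j * g j)"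
      using j j' entry_eq[OF assms(1) j'(1)] by (simp add: strand_def mult_single)
    also have "\<dots> = Poly_Mapping.single (a - rows k ! i) (coef k i j * g j)"
    proof (cases "coef k i j = 0")
      case False
      then have "mon_dvd (rows k ! i) (sh k ! j)" using coef_dvd assms j' by blast
      then have "rows k ! i + ((sh k ! j - rows k ! i) + (a - sh k ! j)) = a"
        by (simp only: add.assoc[symmetric] mon_dvd_diff j'(2))
      then show ?thesis
        by (metis add_diff_cancel_left')
    qed simp
    finally show "d k $$ (i, j) * strand k a g $ j =
        Poly_Mapping.single (a - rows k ! i) (coef k i j * g j)" .
  qed simp
  also have "\<dots> = Poly_Mapping.single (a - rows k ! i) (\<Sum>j\<in>below k a. coef k i j * g j)"
    by (intro poly_mapping_eqI) (simp add: lookup_sum lookup_single_if)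
  finally show ?thesis .
qed

text \<open>The vector \<open>f\<close> may mix degrees: because the differential preserves them,
  the degree \<open>a\<close> part of the image depends only on the degree \<open>a\<close> part of
  \<open>f\<close>. This allows preimages to be cut down to one degree.\<close>

lemma lookup_apply:
  assumes i: "i < length (rows k)" "mon_dvd (rows k ! i) a" and f: "f \<in> free_mod X (length (sh k))"
  shows "Poly_Mapping.lookup ((d k *\<^sub>v f) $ i) (a - rows k ! i) =
    (\<Sum>j\<in>below k a. coef k i j * Poly_Mapping.lookup (f $ j) (a - sh k ! j))"
proof -
  have summand: "Poly_Mapping.lookup (d k $$ (i, j) * f $ j) (a - rows k ! i) =
      (if j \<in> below k a then coef k i j * Poly_Mapping.lookup (f $ j) (a - sh k ! j) else 0)"
    if j: "j < length (sh k)" for j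
  proof (cases "coef k i j = 0")
    case True
    then show ?thesis using entry_eq[OF i(1) j] by simp
  next
    case False
    have dvd: "mon_dvd (rows k ! i) (sh k ! j)"
      by (rule coef_dvd[OF i(1) j False])
    show ?thesis
    proof (cases "j \<in> below k a")
      case True
      then have "mon_dvd (sh k ! j) a" by (simp add: below_def)
      then have "rows k ! i + ((sh k ! j - rows k ! i) + (a - sh k ! j)) = a"
        by (simp only: add.assoc[symmetric] mon_dvd_diff dvd)
      then have "a - rows k ! i = (sh k ! j - rows k ! i) + (a - sh k ! j)"
        by (metis add_diff_cancel_left')
      then show ?thesis
        using True entry_eq[OF i(1) j] by (simp add: lookup_single_times(1))
    next
      case b: False
      have "\<not> mon_dvd (sh k ! j - rows k ! i) (a - rows k ! i)"
      proof
        assume "mon_dvd (sh k ! j - rows k ! i) (a - rows k ! i)"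
        then have "mon_dvd (rows k ! i + (sh k ! j - rows k ! i)) (rows k ! i + (a - rows k ! i))"
          by (simp add: mon_dvd_def lookup_add)
        then show False
          using b j mon_dvd_diff[OF dvd] mon_dvd_diff[OF i(2)] by (simp add: below_def)
      qed
      then show ?thesis
        using b entry_eq[OF i(1) j] by (simp add: lookup_single_times(2))
    qed
  qed
  have "Poly_Mapping.lookup ((d k *\<^sub>v f) $ i) (a - rows k ! i) =
      (\<Sum>j<length (sh k). Poly_Mapping.lookup (d k $$ (i, j) * f $ j) (a - rows k ! i))"
    using apply_d[OF i(1) f] by (simp add: lookup_sum)
  also have "\<dots> = (\<Sum>j<length (sh k). if j \<in> below k a then
      coef k i j * Poly_Mapping.lookup (f $ j) (a - sh k ! j) else 0)"
    by (rule sum.cong) (simp_all add: summand)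
  also have "\<dots> = (\<Sum>j\<in>below k a. coef k i j * Poly_Mapping.lookup (f $ j) (a - sh k ! j))"
    by (subst sum.inter_restrict[symmetric]) (auto simp: below_def intro!: sum.cong)
  finally show ?thesis .
qed

lemma kernel_eq_image:
  "{f \<in> free_mod X (length (sh k)). d k *\<^sub>v f = 0\<^sub>v (dim_row (d k))} =
    {d (Suc k) *\<^sub>v g | g. g \<in> free_mod X (length (sh (Suc k)))}"
  using resolution by (simp add: minimal_free_resolution_def)

lemma cycle_is_boundary:
  assumes "f \<in> free_mod X (length (sh k))" "d k *\<^sub>v f = 0\<^sub>v (dim_row (d k))"
  shows "\<exists>h. h \<in> free_mod X (length (sh (Suc k))) \<and> d (Suc k) *\<^sub>v h = f"
proof -
  have "f \<in> {d (Suc k) *\<^sub>v g | g. g \<in> free_mod X (length (sh (Suc k)))}"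
    unfolding kernel_eq_image[symmetric] using assms by simp
  then show ?thesis by (simp add: eq_commute[of f] conj_commute)
qed

lemma boundary_is_cycle:
  assumes "h \<in> free_mod X (length (sh (Suc k)))"
  shows "d (Suc k) *\<^sub>v h \<in> free_mod X (length (sh k))"
    and "d k *\<^sub>v (d (Suc k) *\<^sub>v h) = 0\<^sub>v (dim_row (d k))"
proof -
  have "d (Suc k) *\<^sub>v h \<in> {f \<in> free_mod X (length (sh k)). d k *\<^sub>v f = 0\<^sub>v (dim_row (d k))}"
    unfolding kernel_eq_image using assms by (intro CollectI exI conjI) (rule refl)
  then show "d (Suc k) *\<^sub>v h \<in> free_mod X (length (sh k))"
    and "d k *\<^sub>v (d (Suc k) *\<^sub>v h) = 0\<^sub>v (dim_row (d k))" by auto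
qed

lemma augmentation_image: "{(d 0 *\<^sub>v f) $ 0 | f. f \<in> free_mod X (length (sh 0))} = I"
  using resolution by (simp add: minimal_free_resolution_def)

text \<open>Exactness of the resolution yields a preimage of the strand that may mix degrees; its
  coefficients in degree \<open>a\<close> already give the required \<open>h\<close>.\<close>

lemma strand_cycle:
  assumes "Poly_Mapping.keys a \<subseteq> X"
    and "\<And>i. i < length (rows k) \<Longrightarrow> (\<Sum>j\<in>below k a. coef k i j * g j) = 0"
  shows "\<exists>h. \<forall>i\<in>below k a. g i = (\<Sum>j\<in>below (Suc k) a. coef (Suc k) i j * h j)"
proof -
  have "d k *\<^sub>v strand k a g = 0\<^sub>v (dim_row (d k))"
  proof (rule eq_vecI)
    fix i assume i: "i < dim_vec (0\<^sub>v (dim_row (d k)) :: ('v, 'k) mpoly vec)"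
    then have "i < length (rows k)" using d_carrier[of k] by simp
    from apply_strand[OF this assms(1), of g] assms(2)[OF this] i
    show "(d k *\<^sub>v strand k a g) $ i = 0\<^sub>v (dim_row (d k)) $ i"
      by (simp del: index_mult_mat_vec)
  qed simp
  then obtain h where h: "h \<in> free_mod X (length (sh (Suc k)))" "d (Suc k) *\<^sub>v h = strand k a g"
    using cycle_is_boundary[OF strand_free[OF assms(1)]] by metis
  have "g i = (\<Sum>j\<in>below (Suc k) a. coef (Suc k) i j * Poly_Mapping.lookup (h $ j) (a - sh (Suc k) ! j))"
    if "i \<in> below k a" for i
    using lookup_apply[of i "Suc k" a, OF _ _ h(1)] lookup_strand[OF that, of g] that h(2)
    by (simp add: below_def)
  then show ?thesis
    by (intro exI ballI)
qed

text \<open>The composite of two differentials vanishes on the \<open>j\<close>-th basis vector;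
  this is read off in the degree of that vector.\<close>

lemma coef_coef:
  assumes i: "i < length (rows k)" and j: "j < length (sh (Suc k))"
  shows "(\<Sum>m<length (sh k). coef k i m * coef (Suc k) m j) = 0"
proof (cases "mon_dvd (rows k ! i) (sh (Suc k) ! j)")
  case True
  define a where "a = sh (Suc k) ! j"
  have a: "Poly_Mapping.keys a \<subseteq> X" using keys_sh j by (simp add: a_def)
  have ja: "j \<in> below (Suc k) a" using j by (simp add: below_def a_def)
  define h where "h = strand (Suc k) a (\<lambda>j'. if j' = j then 1 else 0)"
  have h: "h \<in> free_mod X (length (sh (Suc k)))"
    unfolding h_def by (rule strand_free[OF a])
  have coeffs: "(d (Suc k) *\<^sub>v h) $ m = Poly_Mapping.single (a - sh k ! m) (coef (Suc k) m j)"
    if "m < length (sh k)" for m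
    using apply_strand[OF _ a, of m "Suc k"] that ja by (simp add: h_def if_distrib cong: if_cong)
  note dh = boundary_is_cycle[OF h]
  have "(\<Sum>m<length (sh k). coef k i m * coef (Suc k) m j) =
      (\<Sum>m\<in>below k a. coef k i m * coef (Suc k) m j)"
    using coef_dvd[of _ "Suc k" j] j by (intro sum.mono_neutral_right) (auto simp: below_def a_def)
  also have "\<dots> = (\<Sum>m\<in>below k a. coef k i m * Poly_Mapping.lookup ((d (Suc k) *\<^sub>v h) $ m) (a - sh k ! m))"
    by (rule sum.cong) (auto simp: coeffs below_def)
  also have "\<dots> = 0"
    using lookup_apply[OF i _ dh(1), of a] True dh(2) i d_carrier[of k] by (simp add: a_def)
  finally show ?thesis .
next
  case False
  then have "coef k i m * coef (Suc k) m j = 0" if "m < length (sh k)" for m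
    using coef_dvd[OF i that] coef_dvd[of m "Suc k" j] that j mon_dvd_trans by fastforce
  then show ?thesis by (intro sum.neutral) simp
qed

text \<open>Together with \<open>augmentation_into\<close> this says that the image of the
  augmentation in degree \<open>a\<close> is the degree \<open>a\<close> part of the ideal.\<close>

lemma augmentation_onto:
  assumes "x_mon a \<in> I"
  shows "\<exists>h. (\<Sum>j\<in>below 0 a. coef 0 0 j * h j) = 1"
proof -
  obtain f where f: "f \<in> free_mod X (length (sh 0))" "(d 0 *\<^sub>v f) $ 0 = x_mon a"
    using assms augmentation_image by force
  show ?thesis
    using lookup_apply[of 0 0 a, OF _ _ f(1)] f(2)
    by (intro exI[of _ "\<lambda>j. Poly_Mapping.lookup (f $ j) (a - sh 0 ! j)"]) (simp add: x_mon_def)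
qed

lemma augmentation_into:
  assumes "Poly_Mapping.keys a \<subseteq> X" "(\<Sum>j\<in>below 0 a. coef 0 0 j * g j) \<noteq> 0"
  shows "x_mon a \<in> I"
proof -
  define s where "s = (\<Sum>j\<in>below 0 a. coef 0 0 j * g j)"
  have "(d 0 *\<^sub>v strand 0 a g) $ 0 \<in> I"
    using augmentation_image strand_free[OF assms(1), of 0 g] by blast
  then have "Poly_Mapping.single a s \<in> I"
    using apply_strand[of 0 0 a g] assms(1) by (simp add: s_def)
  \<comment> \<open>The constant \<open>1 / s\<close> normalises the coefficient of the
    monomial.\<close>
  moreover have "Poly_Mapping.single 0 (1 / s) \<in> carrier (poly_ring X :: ('v, 'k) mpoly ring)"
    by (rule single_in_carrier) simp
  ultimately have "Poly_Mapping.single a s * Poly_Mapping.single 0 (1 / s) \<in> I"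
    using ideal.I_r_closed[OF ideal] by fastforce
  then show ?thesis
    using assms(2) by (simp add: mult_single x_mon_def s_def)
qed

text \<open>Between equal degrees an entry is a constant, and minimality forbids nonzero
  constants.\<close>

lemma coef_minimal:
  assumes "i < length (sh k)" "j < length (sh (Suc k))" "sh k ! i = sh (Suc k) ! j"
  shows "coef (Suc k) i j = 0"
proof -
  have "Poly_Mapping.lookup (d (Suc k) $$ (i, j)) 0 = 0"
    using resolution assms by (simp add: minimal_free_resolution_def)
  then show ?thesis
    using assms by (simp add: coef_def)
qed

lemma upward_closed:
  assumes "x_mon a \<in> I" "mon_dvd a b" "Poly_Mapping.keys b \<subseteq> X"
  shows "x_mon b \<in> I"
proof -
  have "x_mon (b - a) \<in> carrier (poly_ring X :: ('v, 'k) mpoly ring)"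
    using assms(3) keys_diff_mon[of b a] by (auto simp: x_mon_def intro!: single_in_carrier)
  then have "x_mon a * x_mon (b - a) \<in> I"
    using ideal.I_r_closed[OF ideal assms(1)] by simp
  then show ?thesis
    by (simp add: x_mon_mult mon_dvd_diff assms(2))
qed

end

section \<open>Slices of a strand\<close>

definition decr :: "'v mon \<Rightarrow> 'v \<Rightarrow> 'v mon" where
  "decr a v = a - Poly_Mapping.single v 1"

lemma lookup_decr:
  "Poly_Mapping.lookup (decr a v) u = (if u = v then Poly_Mapping.lookup a u - 1 else Poly_Mapping.lookup a u)"
  by (simp add: decr_def lookup_minus lookup_single_if)

lemma mon_dvd_decr:
  "mon_dvd a (decr b v) \<longleftrightarrow>
     mon_dvd a b \<and> Poly_Mapping.lookup a v \<le> Poly_Mapping.lookup b v - 1"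
proof
  assume *: "mon_dvd a (decr b v)"
  have "Poly_Mapping.lookup a u \<le> Poly_Mapping.lookup b u" for u
    using *[unfolded mon_dvd_def, rule_format, of u] by (auto simp: lookup_decr split: if_splits)
  then show "mon_dvd a b \<and> Poly_Mapping.lookup a v \<le> Poly_Mapping.lookup b v - 1"
    using *[unfolded mon_dvd_def, rule_format, of v] by (simp add: mon_dvd_def lookup_decr)
next
  assume "mon_dvd a b \<and> Poly_Mapping.lookup a v \<le> Poly_Mapping.lookup b v - 1"
  then show "mon_dvd a (decr b v)"
    by (auto simp: mon_dvd_def lookup_decr)
qed

lemma decr_dvd: "mon_dvd (decr a v) a"
  using mon_dvd_decr[of "decr a v" a v] by simp

lemma keys_decr: "Poly_Mapping.keys a \<subseteq> X \<Longrightarrow> Poly_Mapping.keys (decr a v) \<subseteq> X"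
  using keys_mon_dvd[OF decr_dvd, of a v] by (rule subset_trans)

context graded_resolution
begin

text \<open>Level \<open>0\<close> is left empty: the augmentation is dropped, so the homology at the bottom is that of the
  ideal rather than that of its quotient ring.\<close>

definition slice :: "'v mon \<Rightarrow> 'v set \<Rightarrow> nat \<Rightarrow> nat set" where
  "slice a S k = (case k of 0 \<Rightarrow> {}
     | Suc k \<Rightarrow> {j \<in> below k a. \<forall>v\<in>S. Poly_Mapping.lookup (sh k ! j) v = Poly_Mapping.lookup a v})"

abbreviation exact :: "'v mon \<Rightarrow> 'v set \<Rightarrow> nat \<Rightarrow> bool" where
  "exact a S \<equiv> exact_at coef (slice a S)"

lemma slice_simps [simp]:
  "slice a S 0 = {}"
  "slice a S (Suc k) = {j \<in> below k a. \<forall>v\<in>S. Poly_Mapping.lookup (sh k ! j) v = Poly_Mapping.lookup a v}"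
  by (simp_all add: slice_def)

lemma slice_empty: "slice a {} (Suc k) = below k a"
  by simp

lemma finite_slice: "finite (slice a S k)"
  by (cases k) simp_all

lemma coef_label_le:
  assumes "i < length (sh k)" "j < length (sh (Suc k))" "coef (Suc k) i j \<noteq> 0"
  shows "Poly_Mapping.lookup (sh k ! i) v \<le> Poly_Mapping.lookup (sh (Suc k) ! j) v"
  using coef_dvd[of i "Suc k" j] assms by (simp add: mon_dvd_def)

text \<open>A nonzero product sandwiches the degree of \<open>m\<close> between those of
  \<open>i\<close> and \<open>j\<close>. It therefore divides \<open>a\<close> and agrees with
  \<open>a\<close> on \<open>S\<close>, so that the sum over the slice equals the full sum of
  \<open>coef_coef\<close>.\<close>

lemma slice_dd:
  assumes "i \<in> slice a S k" "j \<in> slice a S (Suc (Suc k))"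
  shows "(\<Sum>m\<in>slice a S (Suc k). coef k i m * coef (Suc k) m j) = 0"
proof (cases k)
  case (Suc l)
  have ij: "i < length (sh l)" "j < length (sh (Suc k))" using assms Suc by (auto simp: below_def)
  have "coef k i m * coef (Suc k) m j = 0" if m: "m < length (sh k)" "m \<notin> slice a S (Suc k)" for m
  proof (rule ccontr)
    assume "\<not> ?thesis"
    then have "\<And>v. Poly_Mapping.lookup (sh l ! i) v \<le> Poly_Mapping.lookup (sh k ! m) v"
      "\<And>v. Poly_Mapping.lookup (sh k ! m) v \<le> Poly_Mapping.lookup (sh (Suc k) ! j) v"
      using coef_label_le ij m Suc by auto
    moreover have "\<And>v. Poly_Mapping.lookup (sh (Suc k) ! j) v \<le> Poly_Mapping.lookup a v"
      "\<And>v. v \<in> S \<Longrightarrow> Poly_Mapping.lookup (sh l ! i) v = Poly_Mapping.lookup a v"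
      using assms Suc by (auto simp: below_def mon_dvd_def)
    ultimately have "mon_dvd (sh k ! m) a"
      "\<And>v. v \<in> S \<Longrightarrow> Poly_Mapping.lookup (sh k ! m) v = Poly_Mapping.lookup a v"
      unfolding mon_dvd_def by (metis le_trans, metis le_trans le_antisym)
    then have "m \<in> slice a S (Suc k)"
      using m(1) by (simp add: below_def)
    then show False using m(2) by simp
  qed
  moreover have "slice a S (Suc k) \<subseteq> {..<length (sh k)}"
    by (auto simp: below_def)
  ultimately have "(\<Sum>m\<in>slice a S (Suc k). coef k i m * coef (Suc k) m j) =
      (\<Sum>m<length (sh k). coef k i m * coef (Suc k) m j)"
    by (intro sum.mono_neutral_left) auto
  also have "\<dots> = 0"
    using coef_coef[of i k j] ij Suc by simp
  finally show ?thesis .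
qed (use assms in simp)

text \<open>At \<open>v\<close> a divisor of \<open>a\<close> either has the full exponent or drops
  by at least one.\<close>

lemma slice_split:
  assumes "v \<notin> S" "Poly_Mapping.lookup a v > 0"
  shows "slice (decr a v) S k \<union> slice a (insert v S) k = slice a S k"
proof (cases k)
  case (Suc l)
  have eq: "Poly_Mapping.lookup (decr a v) u = Poly_Mapping.lookup a u" if "u \<in> S" for u
    using that assms(1) by (auto simp: lookup_decr)
  have "Poly_Mapping.lookup b v \<le> Poly_Mapping.lookup a v - 1 \<or>
      Poly_Mapping.lookup b v = Poly_Mapping.lookup a v" if "mon_dvd b a" for b
  proof -
    have "Poly_Mapping.lookup b v \<le> Poly_Mapping.lookup a v" using that by (simp add: mon_dvd_def)
    then show ?thesis by linarith
  qed
  then show ?thesis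
    unfolding Suc by (auto simp: below_def mon_dvd_decr eq)
qed simp

text \<open>A nonzero coefficient leads from a degree to one of its divisors, so what lies below
  \<open>decr a v\<close> is closed under the differential and forms the subcomplex.\<close>

lemma chain_split_slice:
  assumes "v \<notin> S" "Poly_Mapping.lookup a v > 0"
  shows "chain_split coef (slice (decr a v) S) (slice a (insert v S))"
proof
  show "slice (decr a v) S k \<inter> slice a (insert v S) k = {}" for k
    using assms(2) by (cases k) (auto simp: below_def mon_dvd_decr)
  show "coef k i j = 0"
    if ij: "i \<in> slice a (insert v S) k" "j \<in> slice (decr a v) S (Suc k)" for k i j
  proof (cases k)
    case (Suc l)
    show ?thesis
    proof (rule ccontr)
      assume "\<not> ?thesis"
      moreover have "i < length (sh l)" "j < length (sh (Suc l))"
        using ij Suc by (auto simp: below_def)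
      ultimately have "Poly_Mapping.lookup (sh l ! i) v \<le> Poly_Mapping.lookup (sh k ! j) v"
        using coef_label_le Suc by simp
      then show False
        using ij Suc assms(2) by (auto simp: below_def mon_dvd_decr)
    qed
  qed (use ij in simp)
qed (simp_all only: slice_split[OF assms] slice_dd finite_slice)

section \<open>Exact sequences that fix one more variable\<close>

context
  fixes a :: "'v mon" and v :: 'v and S :: "'v set"
  assumes v: "v \<notin> S" "Poly_Mapping.lookup a v > 0"
begin

lemma exact_slice:
  assumes "exact (decr a v) S k" "exact a (insert v S) k"
  shows "exact a S k"
  using chain_split.exact_total[OF chain_split_slice[OF v] assms] unfolding slice_split[OF v] .

lemma exact_insert:
  assumes "exact a S k" "\<And>k'. k = Suc k' \<Longrightarrow> exact (decr a v) S k'"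
  shows "exact a (insert v S) k"
proof (rule chain_split.exact_quotient[OF chain_split_slice[OF v]])
  show "exact_at coef (\<lambda>k. slice (decr a v) S k \<union> slice a (insert v S) k) k"
    unfolding slice_split[OF v] by (rule assms(1))
qed (use assms(2) in simp_all)

lemma exact_lower:
  assumes "exact a (insert v S) (Suc k)" "exact a S k"
  shows "exact (decr a v) S k"
proof (rule chain_split.exact_sub[OF chain_split_slice[OF v] assms(1)])
  show "exact_at coef (\<lambda>k. slice (decr a v) S k \<union> slice a (insert v S) k) k"
    unfolding slice_split[OF v] by (rule assms(2))
qed

end

lemma slice_insert_zero:
  assumes "Poly_Mapping.lookup a v = 0"
  shows "slice a (insert v S) = slice a S"
proof
  fix k
  show "slice a (insert v S) k = slice a S k"
    using assms by (cases k) (auto simp: below_def mon_dvd_def dest: spec[of _ v])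
qed

section \<open>Vanishing results for slices\<close>

lemma exact_below_Suc:
  assumes "Poly_Mapping.keys a \<subseteq> X"
  shows "exact a {} (Suc k)"
  unfolding exact_at_def slice_empty
proof (intro allI impI)
  fix g assume g: "\<forall>i\<in>below k a. (\<Sum>j\<in>below (Suc k) a. coef (Suc k) i j * g j) = 0"
  show "\<exists>h. \<forall>i\<in>below (Suc k) a. g i = (\<Sum>j\<in>below (Suc (Suc k)) a. coef (Suc (Suc k)) i j * h j)"
  proof (rule strand_cycle[OF assms])
    fix i assume i: "i < length (rows (Suc k))"
    show "(\<Sum>j\<in>below (Suc k) a. coef (Suc k) i j * g j) = 0"
    proof (cases "i \<in> below k a")
      \<comment> \<open>Row \<open>i\<close> lies outside the strand: a nonzero entry in it would
        make its degree divide \<open>a\<close>.\<close>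
      case False
      then have "coef (Suc k) i j = 0" if "j \<in> below (Suc k) a" for j
        using that i coef_dvd[of i "Suc k" j] mon_dvd_trans by (auto simp: below_def)
      then show ?thesis by (intro sum.neutral) simp
    qed (use g in simp)
  qed
qed

text \<open>With level \<open>0\<close> empty, every chain at level \<open>1\<close> counts as a
  cycle, so exactness says that all of them are boundaries. The boundaries are the kernel of the
  augmentation, hence this happens exactly if the ideal vanishes in degree \<open>a\<close>.\<close>

lemma exact_below_zero:
  assumes "Poly_Mapping.keys a \<subseteq> X"
  shows "exact a {} 0 \<longleftrightarrow> x_mon a \<notin> I"
proof
  assume ex: "exact a {} 0"
  show "x_mon a \<notin> I"
  proof
    assume "x_mon a \<in> I"
    \<comment> \<open>A chain with augmentation \<open>1\<close> cannot be a boundary, because the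
      augmentation kills boundaries.\<close>
    then obtain h where h: "(\<Sum>j\<in>below 0 a. coef 0 0 j * h j) = 1"
      using augmentation_onto by blast
    obtain e where e: "\<forall>i\<in>below 0 a. h i = (\<Sum>j\<in>below (Suc 0) a. coef (Suc 0) i j * e j)"
      using exact_atD[OF ex, of h] unfolding slice_empty by auto
    have zero: "(\<Sum>m\<in>below 0 a. coef 0 0 m * coef (Suc 0) m j) = 0" if j: "j \<in> below (Suc 0) a" for j
    proof -
      have "(\<Sum>m\<in>below 0 a. coef 0 0 m * coef (Suc 0) m j) =
          (\<Sum>m<length (sh 0). coef 0 0 m * coef (Suc 0) m j)"
        using j coef_dvd[of _ "Suc 0" j] mon_dvd_trans
        by (intro sum.mono_neutral_left) (auto simp: below_def)
      then show ?thesis using coef_coef[of 0 0 j] j by (simp add: below_def)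
    qed
    have "(\<Sum>m\<in>below 0 a. coef 0 0 m * h m) =
        (\<Sum>m\<in>below 0 a. \<Sum>j\<in>below (Suc 0) a. coef 0 0 m * coef (Suc 0) m j * e j)"
      using e by (intro sum.cong) (simp_all add: sum_distrib_left mult.assoc)
    also have "\<dots> = (\<Sum>j\<in>below (Suc 0) a. (\<Sum>m\<in>below 0 a. coef 0 0 m * coef (Suc 0) m j) * e j)"
      unfolding sum_distrib_right by (rule sum.swap)
    also have "\<dots> = 0"
      using zero by simp
    finally show False using h by simp
  qed
next
  assume notin: "x_mon a \<notin> I"
  show "exact a {} 0"
    unfolding exact_at_def slice_empty
  proof (intro allI impI)
    fix g :: "nat \<Rightarrow> 'k"
    show "\<exists>h. \<forall>i\<in>below 0 a. g i = (\<Sum>j\<in>below (Suc 0) a. coef (Suc 0) i j * h j)"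
      using augmentation_into[OF assms, of g] notin by (intro strand_cycle[OF assms]) auto
  qed
qed

text \<open>Divisors of a monomial outside \<open>I\<close> lie outside \<open>I\<close> too. So
  every strand that occurs when the variables of \<open>S\<close> are added one by one is acyclic,
  and the exact sequences carry this over to \<open>S\<close>.\<close>

lemma exact_notin:
  assumes "finite S" "Poly_Mapping.keys a \<subseteq> X" "x_mon a \<notin> I"
  shows "exact a S k"
  using assms
proof (induction S arbitrary: a k rule: finite_induct)
  case (empty a k)
  then show ?case
    using exact_below_Suc exact_below_zero by (cases k) auto
next
  case (insert v S a k)
  show ?case
  proof (cases "Poly_Mapping.lookup a v = 0")
    case True
    then show ?thesis using insert by (simp only: slice_insert_zero)
  next
    case False
    then have v: "v \<notin> S" "Poly_Mapping.lookup a v > 0" using insert by auto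
    have "x_mon (decr a v) \<notin> I"
      using insert.prems upward_closed[OF _ decr_dvd] by blast
    then have "exact (decr a v) S l" for l
      by (rule insert.IH[OF keys_decr[OF insert.prems(1)]])
    then show ?thesis
      by (intro exact_insert[OF v insert.IH[OF insert.prems]])
  qed
qed

text \<open>In both degrees \<open>decr a v\<close> and \<open>a\<close> the ideal is
  one-dimensional, and the inclusion of the smaller strand into the larger one identifies their
  homology. The quotient, which is the slice with \<open>v\<close> fixed, is therefore
  acyclic.\<close>

lemma exact_cone_base:
  assumes a: "Poly_Mapping.keys a \<subseteq> X" "Poly_Mapping.lookup a v > 0"
    and mem: "x_mon (decr a v) \<in> I"
  shows "exact a {v} k"
proof -
  let ?a = "decr a v"
  have a': "Poly_Mapping.keys ?a \<subseteq> X" by (rule keys_decr[OF a(1)])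
  \<comment> \<open>With the augmentation put back, both strands in the exact sequence become acyclic.\<close>
  define L where "L = (slice ?a {})(0 := {0})"
  interpret split: chain_split coef "slice ?a {}" "slice a {v}"
    using chain_split_slice[of v "{}" a] a by simp
  have B: "slice ?a {} l \<union> slice a {v} l = slice a {} l" for l
    using slice_split[of v "{}" a l] a by simp
  have LB: "L (Suc l) \<union> slice a {v} (Suc l) = below l a" for l
    unfolding L_def slice_empty[symmetric] using B[of "Suc l"] by (simp del: slice_simps(2))
  interpret aug: chain_split coef L "slice a {v}"
  proof
    show "finite (L l)" "finite (slice a {v} l)" for l
      by (auto simp: L_def finite_slice)
    show "L l \<inter> slice a {v} l = {}" for l
      using split.disjoint[of l] by (auto simp: L_def)
    show "coef l i j = 0" if "i \<in> slice a {v} l" "j \<in> L (Suc l)" for l i j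
      using split.closed that by (auto simp: L_def simp del: slice_simps(2))
    show "(\<Sum>m\<in>L (Suc l) \<union> slice a {v} (Suc l). coef l i m * coef (Suc l) m j) = 0"
      if "i \<in> L l \<union> slice a {v} l" "j \<in> L (Suc (Suc l)) \<union> slice a {v} (Suc (Suc l))" for l i j
    proof (cases l)
      case 0
      have j: "j \<in> below (Suc 0) a"
        using that(2) unfolding 0 LB .
      have i: "i = 0" using that 0 by (simp add: L_def)
      have "(\<Sum>m\<in>below 0 a. coef 0 0 m * coef (Suc 0) m j) =
          (\<Sum>m<length (sh 0). coef 0 0 m * coef (Suc 0) m j)"
        using j coef_dvd[of _ "Suc 0" j] mon_dvd_trans
        by (intro sum.mono_neutral_left) (auto simp: below_def)
      also have "\<dots> = 0" using coef_coef[of 0 0 j] j by (simp add: below_def)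
      finally show ?thesis
        unfolding 0 i LB .
    qed (use split.dd[of i l j] that in \<open>simp add: L_def del: slice_simps(2)\<close>)
  qed
  have total: "exact_at coef (\<lambda>l. L l \<union> slice a {v} l) l" for l
  proof (cases l)
    case 0
    have "\<exists>h. \<forall>i\<in>below 0 a. g i = (\<Sum>j\<in>below (Suc 0) a. coef (Suc 0) i j * h j)"
      if "(\<Sum>j\<in>below 0 a. coef 0 0 j * g j) = 0" for g
      using that by (intro strand_cycle[OF a(1)]) simp
    then show ?thesis
      unfolding exact_at_def 0 LB by (simp add: L_def)
  next
    case (Suc l')
    show ?thesis
      using exact_below_Suc[OF a(1), of l'] unfolding exact_at_def Suc LB slice_empty .
  qed
  show ?thesis
  proof (rule aug.exact_quotient[OF total])
    \<comment> \<open>A chain of augmentation \<open>1\<close> exists below \<open>decr a v\<close>;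
      its multiple by \<open>f 0\<close> reaches the prescribed value at level
      \<open>0\<close>.\<close>
    fix f :: "nat \<Rightarrow> 'k"
    obtain h where h: "(\<Sum>j\<in>below 0 ?a. coef 0 0 j * h j) = 1"
      using augmentation_onto[OF mem] by blast
    then have "(\<Sum>j\<in>below 0 ?a. coef 0 0 j * (f 0 * h j)) = f 0"
      by (simp add: mult.left_commute sum_distrib_left[symmetric])
    then show "\<exists>h. \<forall>i\<in>L 0. f i = (\<Sum>j\<in>L 1. coef 0 i j * h j)"
      by (intro exI[of _ "\<lambda>j. f 0 * h j"]) (simp add: L_def)
  next
    fix k' assume "k = Suc k'"
    show "exact_at coef L k'"
    proof (cases k')
      case 0
      have "\<exists>h. \<forall>i\<in>below 0 ?a. g i = (\<Sum>j\<in>below (Suc 0) ?a. coef (Suc 0) i j * h j)"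
        if "(\<Sum>j\<in>below 0 ?a. coef 0 0 j * g j) = 0" for g
        using that by (intro strand_cycle[OF a']) simp
      then show ?thesis
        unfolding exact_at_def 0 L_def by simp
    next
      case (Suc l)
      then show ?thesis
        using exact_below_Suc[OF a', of l] unfolding exact_at_def L_def by simp
    qed
  qed
qed

text \<open>The last hypothesis makes \<open>v\<close> the apex of a cone: dividing by
  \<open>v\<close> stays in the ideal for all degrees that differ from \<open>a\<close> only on
  \<open>S\<close>. Adding \<open>u\<close> to \<open>S\<close> involves the degrees
  \<open>a\<close> and \<open>decr a u\<close>, and both inherit the hypothesis for the smaller
  set.\<close>

lemma exact_cone:
  assumes "finite S" "v \<notin> S" "Poly_Mapping.keys a \<subseteq> X" "Poly_Mapping.lookup a v > 0"
    and "\<And>b. Poly_Mapping.keys b \<subseteq> X \<Longrightarrow> x_mon b \<in> I \<Longrightarrow>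
      (\<And>u. u \<notin> S \<Longrightarrow> Poly_Mapping.lookup b u = Poly_Mapping.lookup a u) \<Longrightarrow>
      x_mon (decr b v) \<in> I"
  shows "exact a (insert v S) k"
  using assms
proof (induction S arbitrary: a k rule: finite_induct)
  case (empty a k)
  show ?case
  proof (cases "x_mon a \<in> I")
    case True
    then show ?thesis using empty by (intro exact_cone_base) auto
  next
    case False
    then show ?thesis using empty by (intro exact_notin) auto
  qed
next
  case (insert u S a k)
  have IH: "exact a (insert v S) l" for l
    using insert by (intro insert.IH) auto
  show ?case
  proof (cases "Poly_Mapping.lookup a u = 0")
    case True
    then show ?thesis
      using IH slice_insert_zero[of a u "insert v S"] by (simp only: insert_commute)
  next
    case False
    then have u: "u \<notin> insert v S" "Poly_Mapping.lookup a u > 0"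
      using insert by auto
    have "exact (decr a u) (insert v S) l" for l
    proof (rule insert.IH)
      show "v \<notin> S" "Poly_Mapping.keys (decr a u) \<subseteq> X"
        "0 < Poly_Mapping.lookup (decr a u) v"
        using insert.prems insert.hyps keys_decr[OF insert.prems(2)] by (auto simp: lookup_decr)
      fix b assume b: "Poly_Mapping.keys b \<subseteq> X" "x_mon b \<in> I"
        "\<And>w. w \<notin> S \<Longrightarrow> Poly_Mapping.lookup b w = Poly_Mapping.lookup (decr a u) w"
      show "x_mon (decr b v) \<in> I"
        using b(3) by (intro insert.prems(4)[OF b(1,2)]) (simp add: lookup_decr)
    qed
    then have "exact a (insert u (insert v S)) k"
      using IH by (intro exact_insert[OF u])
    then show ?thesis by (simp only: insert_commute)
  qed
qed

text \<open>Fixing all variables leaves only basis elements of degree exactly \<open>a\<close>, and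
  minimality makes the differential between them zero. Exactness then means that there are none at
  this level.\<close>

lemma exact_iff_not_shift:
  assumes "Poly_Mapping.keys a \<subseteq> X"
  shows "exact a X k \<longleftrightarrow> a \<notin> set (sh k)"
proof -
  have slice: "slice a X (Suc l) = {j. j < length (sh l) \<and> sh l ! j = a}" for l
  proof -
    have "b = a" if "Poly_Mapping.keys b \<subseteq> X" "\<forall>v\<in>X. Poly_Mapping.lookup b v = Poly_Mapping.lookup a v" for b
      using that assms by (intro poly_mapping_eqI) (metis in_keys_iff subsetD)
    then show ?thesis
      using keys_sh by (auto simp: below_def)
  qed
  have zero: "coef l i j = 0" if "i \<in> slice a X l" "j \<in> slice a X (Suc l)" for l i j
    using that coef_minimal by (cases l) (auto simp only: slice slice_simps(1) mem_Collect_eq)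
  have "exact a X k \<longleftrightarrow> (\<forall>g :: nat \<Rightarrow> 'k. \<forall>i\<in>slice a X (Suc k). g i = 0)"
    unfolding exact_at_def using zero by (simp del: slice_simps(2))
  also have "\<dots> \<longleftrightarrow> slice a X (Suc k) = {}"
  proof
    assume "\<forall>g :: nat \<Rightarrow> 'k. \<forall>i\<in>slice a X (Suc k). g i = 0"
    from this[rule_format, of _ "\<lambda>_. 1"] show "slice a X (Suc k) = {}"
      by (simp del: slice_simps(2)) blast
  qed blast
  also have "\<dots> \<longleftrightarrow> a \<notin> set (sh k)"
    unfolding slice by (auto simp: in_set_conv_nth)
  finally show ?thesis .
qed

end

section \<open>Independent sets of a clique corona\<close>

definition char_mon :: "'v set \<Rightarrow> 'v mon" where
  "char_mon B = (\<Sum>v\<in>B. Poly_Mapping.single v 1)"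

lemma lookup_char_mon:
  "finite B \<Longrightarrow> Poly_Mapping.lookup (char_mon B) v = (if v \<in> B then 1 else 0)"
  by (simp add: char_mon_def lookup_sum lookup_single_if)

lemma keys_char_mon: "finite B \<Longrightarrow> Poly_Mapping.keys (char_mon B) = B"
  by (auto simp: in_keys_iff lookup_char_mon split: if_splits)

lemma decr_char_mon:
  assumes "finite B" "v \<in> B"
  shows "decr (char_mon B) v = char_mon (B - {v})"
  using assms by (intro poly_mapping_eqI) (simp add: lookup_decr lookup_char_mon)

locale clique_corona =
  fixes V :: "'v set" and E :: "'v set set" and n :: nat
    and w :: "nat \<Rightarrow> 'v" and T :: "nat \<Rightarrow> 'v set"
  assumes graph: "simple_graph V E" and bij: "bij_betw w {1..n} V"
    and finite_T: "i \<in> {1..n} \<Longrightarrow> finite (T i)"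
    and disjoint_T: "disjoint_family_on T {1..n}"
    and T_V: "i \<in> {1..n} \<Longrightarrow> T i \<inter> V = {}"
    and card_T: "i \<in> {1..n} \<Longrightarrow> card (T i) \<ge> 2"
begin

definition X :: "'v set" where
  "X = corona_verts V n T"

definition indep :: "'v set \<Rightarrow> bool" where
  "indep A \<longleftrightarrow> A \<subseteq> X \<and> (\<forall>e\<in>corona_edges E n w T. \<not> e \<subseteq> A)"

definition block :: "nat \<Rightarrow> 'v set" where
  "block i = insert (w i) (T i)"

lemma V_eq: "V = w ` {1..n}"
  using bij by (simp add: bij_betw_def)

lemma X_eq: "X = (\<Union>i\<in>{1..n}. block i)"
proof -
  have "X = w ` {1..n} \<union> (\<Union>i\<in>{1..n}. T i)"
    unfolding X_def corona_verts_def by (simp only: V_eq[symmetric])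
  then show ?thesis
    unfolding block_def by auto
qed

lemma finite_X: "finite X"
  unfolding X_eq using finite_T by (simp add: block_def)

lemma V_sub_X: "V \<subseteq> X" and T_sub_X: "i \<in> {1..n} \<Longrightarrow> T i \<subseteq> X"
  by (auto simp: X_def corona_verts_def)

lemma block_disjoint:
  assumes "i \<in> {1..n}" "j \<in> {1..n}" "x \<in> block i" "x \<in> block j"
  shows "i = j"
proof -
  have "w i \<in> V" "w j \<in> V" using assms by (auto simp: V_eq)
  moreover have "w i = w j \<Longrightarrow> i = j"
    using bij assms by (auto simp: bij_betw_def dest: inj_onD)
  moreover have "x \<in> T i \<Longrightarrow> x \<in> T j \<Longrightarrow> i = j"
    using disjoint_T assms unfolding disjoint_family_on_def by blast
  ultimately show ?thesis
    using assms T_V unfolding block_def by blast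
qed

lemma T_block: "x \<in> T i \<Longrightarrow> x \<in> block i"
  by (simp add: block_def)

text \<open>Each block is a clique, and every edge of the corona outside \<open>E\<close> lies in a
  block.\<close>

lemma indep_iff:
  "indep A \<longleftrightarrow> A \<subseteq> X \<and> (\<forall>i\<in>{1..n}. \<forall>x\<in>A \<inter> block i. \<forall>y\<in>A \<inter> block i. x = y) \<and> (\<forall>e\<in>E. \<not> e \<subseteq> A)"
    (is "_ \<longleftrightarrow> ?R")
proof
  assume A: "indep A"
  have "x = y" if "i \<in> {1..n}" "x \<in> A" "x \<in> block i" "y \<in> A" "y \<in> block i" for i x y
  proof (rule ccontr)
    assume "x \<noteq> y"
    have "{x, y} \<in> complete_edges (T i) \<union> {{w i, x} | x. x \<in> T i}"
    proof (cases "x \<in> T i \<and> y \<in> T i")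
      case True
      then show ?thesis
        using \<open>x \<noteq> y\<close> unfolding complete_edges_def by blast
    next
      case False
      then have "(x = w i \<and> y \<in> T i) \<or> (y = w i \<and> x \<in> T i)"
        using that \<open>x \<noteq> y\<close> by (auto simp: block_def)
      then show ?thesis
        by (auto simp: insert_commute)
    qed
    then have "{x, y} \<in> corona_edges E n w T"
      using that(1) unfolding corona_edges_def by blast
    with A have "\<not> {x, y} \<subseteq> A"
      unfolding indep_def by blast
    then show False
      using that by simp
  qed
  moreover have "\<not> e \<subseteq> A" if "e \<in> E" for e
    using A that by (simp add: indep_def corona_edges_def)
  ultimately show ?R
    using A by (auto simp: indep_def)
next
  assume R: ?R
  have "\<not> e \<subseteq> A" if e: "e \<in> corona_edges E n w T" for e
  proof
    assume "e \<subseteq> A"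
    have "e \<in> E \<or> (\<exists>i\<in>{1..n}. \<exists>x y. e = {x, y} \<and> x \<noteq> y \<and> x \<in> block i \<and> y \<in> block i)"
    proof -
      consider "e \<in> E" | i where "i \<in> {1..n}" "e \<in> complete_edges (T i)"
        | i x where "i \<in> {1..n}" "x \<in> T i" "e = {w i, x}"
        using e by (auto simp: corona_edges_def)
      then show ?thesis
      proof cases
        case (2 i)
        then obtain x y where "x \<in> T i" "y \<in> T i" "x \<noteq> y" "e = {x, y}"
          by (auto simp: complete_edges_def)
        then show ?thesis using 2 by (metis T_block)
      next
        case (3 i x)
        then have "w i \<noteq> x" "x \<in> block i" "w i \<in> block i" 
          using T_V[of i] V_eq by (auto simp: block_def)
        then show ?thesis using 3 by metis
      qed blast
    qed
    then show False
    proof (elim disjE bexE exE conjE)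
      assume "e \<in> E"
      then show False using R \<open>e \<subseteq> A\<close> by blast
    next
      fix i x y assume "i \<in> {1..n}" "e = {x, y}" "x \<noteq> y" "x \<in> block i" "y \<in> block i"
      then show False using R \<open>e \<subseteq> A\<close> by blast
    qed
  qed
  then show "indep A"
    using R by (simp add: indep_def)
qed

lemma indep_subset: "indep A \<Longrightarrow> B \<subseteq> A \<Longrightarrow> indep B"
  unfolding indep_def by blast

lemma indep_finite: "indep A \<Longrightarrow> finite A"
  unfolding indep_def using finite_X finite_subset by blast

lemma indep_block_unique: "indep A \<Longrightarrow> i \<in> {1..n} \<Longrightarrow> x \<in> A \<Longrightarrow> x \<in> block i \<Longrightarrow> y \<in> A \<Longrightarrow> y \<in> block i \<Longrightarrow> x = y"
  by (simp add: indep_iff)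

lemma edge_sub_V: "e \<in> E \<Longrightarrow> e \<subseteq> V"
  using graph by (auto simp: simple_graph_def complete_edges_def dest!: subsetD)

text \<open>All neighbours of a vertex of \<open>T i\<close> lie in \<open>block i\<close>.\<close>

lemma indep_insert:
  assumes "indep A" "i \<in> {1..n}" "A \<inter> block i = {}" "y \<in> T i"
  shows "indep (insert y A)"
  unfolding indep_iff
proof (intro conjI ballI)
  show "insert y A \<subseteq> X"
    using assms T_sub_X by (auto simp: indep_iff)
  fix j x z assume "j \<in> {1..n}" "x \<in> insert y A \<inter> block j" "z \<in> insert y A \<inter> block j"
  then show "x = z"
    using assms block_disjoint[of i j y] indep_block_unique[of A j x z] by (auto simp: T_block)
next
  fix e assume "e \<in> E"
  then show "\<not> e \<subseteq> insert y A"
    using edge_sub_V[of e] T_V[OF assms(2)] assms unfolding indep_iff by blast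
qed

definition blocks :: "'v set \<Rightarrow> nat set" where
  "blocks A = {i \<in> {1..n}. A \<inter> block i \<noteq> {}}"

lemma blocks_sub: "blocks A \<subseteq> {1..n}"
  unfolding blocks_def by (rule Collect_restrict)

lemma finite_blocks: "finite (blocks A)"
  using blocks_sub by (rule finite_subset) simp

text \<open>Being a clique, a block contains at most one vertex of \<open>A\<close>, so choosing a
  vertex in each block that is met gives a bijection onto \<open>A\<close>.\<close>

lemma card_blocks:
  assumes "indep A"
  shows "card (blocks A) = card A"
proof -
  have "\<exists>f. \<forall>i\<in>blocks A. f i \<in> A \<and> f i \<in> block i"
    by (rule bchoice) (auto simp: blocks_def)
  then obtain f where f: "\<And>i. i \<in> blocks A \<Longrightarrow> f i \<in> A \<and> f i \<in> block i"
    by blast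
  have "bij_betw f (blocks A) A"
    unfolding bij_betw_def
  proof
    show "inj_on f (blocks A)"
    proof (rule inj_onI)
      fix i j assume ij: "i \<in> blocks A" "j \<in> blocks A" "f i = f j"
      then show "i = j"
        using f[OF ij(1)] f[OF ij(2)] block_disjoint[of i j "f i"] by (simp add: blocks_def)
    qed
    have "x \<in> f ` blocks A" if "x \<in> A" for x
    proof -
      have "x \<in> X"
        using that assms by (auto simp: indep_def)
      then obtain i where i: "i \<in> {1..n}" "x \<in> block i"
        unfolding X_eq by blast
      then have "i \<in> blocks A" using that by (auto simp: blocks_def)
      then show ?thesis
        using f[of i] indep_block_unique[OF assms i(1), of x "f i"] that i by blast
    qed
    then show "f ` blocks A = A"
      using f by blast
  qed
  then show ?thesis
    by (rule bij_betw_same_card)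
qed

lemma card_indep_le: "indep A \<Longrightarrow> card A \<le> n"
  using card_blocks[of A] card_mono[OF _ blocks_sub, of A] by simp

lemma missed_block:
  assumes "indep A" "card A < n"
  obtains i where "i \<in> {1..n}" "A \<inter> block i = {}"
proof -
  have "blocks A \<noteq> {1..n}"
    using card_blocks[OF assms(1)] assms(2) by auto
  then obtain i where "i \<in> {1..n}" "i \<notin> blocks A"
    using blocks_sub by blast
  then show ?thesis
    using that[of i] unfolding blocks_def by blast
qed

text \<open>Generators are complements of independent sets, which reverses the roles: multiplying by
  \<open>xs ! t\<close> removes that vertex from \<open>B\<close>, and dividing by
  \<open>xs ! j\<close> puts \<open>xs ! j\<close> into \<open>B\<close>.\<close>

lemma exchange:
  assumes xs: "set vs = V" "set ts = (\<Union>i\<in>{1..n}. T i)" "xs = vs @ ts"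
    and A: "indep A" and B: "indep B" and card: "card A = card B"
    and t: "t < length xs" "xs ! t \<in> B" "xs ! t \<notin> A"
    and agree: "\<And>i. i < t \<Longrightarrow> xs ! i \<in> A \<longleftrightarrow> xs ! i \<in> B"
  shows "\<exists>j. t < j \<and> j < length xs \<and> xs ! j \<notin> B \<and> indep (insert (xs ! j) (B - {xs ! t}))"
proof -
  define x where "x = xs ! t"
  have x: "x \<in> B" "x \<notin> A" using t by (simp_all add: x_def)
  show ?thesis
  proof (cases "t < length vs")
    \<comment> \<open>A vertex \<open>w i\<close> of \<Gamma> is traded for any \<open>y\<close> in
      \<open>T i\<close>, which comes later because \<open>ts\<close> follows
      \<open>vs\<close>.\<close>
    case True
    then have "x \<in> V" using xs by (auto simp: x_def nth_append)
    then obtain i where i: "i \<in> {1..n}" "x = w i" by (auto simp: V_eq)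
    obtain y where y: "y \<in> T i" using card_T[OF i(1)] by fastforce
    then have "y \<in> set ts" unfolding xs(2) using i(1) by blast
    then obtain j where j: "j < length ts" "ts ! j = y" unfolding in_set_conv_nth by blast
    have xi: "x \<in> block i" using i by (simp add: block_def)
    have "y \<noteq> x" using y T_V[OF i(1)] \<open>x \<in> V\<close> by blast
    then have "y \<notin> B"
      using indep_block_unique[OF B i(1) x(1) xi _ T_block[OF y]] by blast
    moreover have "indep (insert y (B - {x}))"
    proof (rule indep_insert[OF _ i(1) _ y])
      show "indep (B - {x})" using B by (rule indep_subset) blast
      show "(B - {x}) \<inter> block i = {}"
        using indep_block_unique[OF B i(1) x(1) xi] by blast
    qed
    ultimately show ?thesis
      using j True xs by (intro exI[of _ "length vs + j"]) (simp add: x_def nth_append)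
  next
    case False
    then have "x \<in> set ts" using t xs by (auto simp: x_def nth_append)
    then obtain i where i: "i \<in> {1..n}" "x \<in> T i" unfolding xs(2) by blast
    \<comment> \<open>All of \<open>V\<close> stands before position \<open>t\<close>, so
      \<open>A\<close> and \<open>B\<close> agree there and differ only in the sets
      \<open>T i\<close>.\<close>
    have AV: "z \<in> A \<longleftrightarrow> z \<in> B" if "z \<in> V" for z
    proof -
      have "z \<in> set vs" using that by (simp only: xs(1))
      then obtain j where "j < length vs" "vs ! j = z" unfolding in_set_conv_nth by blast
      then show ?thesis
        using agree[of j] False xs by (simp add: nth_append)
    qed
    \<comment> \<open>Before \<open>t\<close> the two sets agree, and at \<open>t\<close> stands
      \<open>x\<close>, which is not in \<open>A\<close>; so an element of \<open>A\<close> outside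
      \<open>B\<close> comes after \<open>t\<close>.\<close>
    have later: ?thesis if z: "z \<in> A" "z \<notin> B" "indep (insert z (B - {x}))" for z
    proof -
      have "set xs = X"
        by (simp add: xs X_def corona_verts_def)
      then have "z \<in> set xs"
        using z(1) A unfolding indep_def by blast
      then obtain j where j: "j < length xs" "xs ! j = z" unfolding in_set_conv_nth by blast
      have "t < j"
        using j z agree[of j] x unfolding x_def by (metis linorder_neqE_nat)
      then show ?thesis
        using j z by (auto simp: x_def)
    qed
    have T_A: "z \<in> T l" if "z \<in> A" "z \<notin> B" "l \<in> {1..n}" "z \<in> block l" for z l
      using that AV[of z] by (auto simp: block_def V_eq)
    show ?thesis
    proof (cases "i \<in> blocks A")
      case True
      then obtain z where z: "z \<in> A" "z \<in> block i" by (auto simp: blocks_def)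
      then have zB: "z \<notin> B"
        using indep_block_unique[OF B i(1) x(1) T_block[OF i(2)]] x by blast
      show ?thesis
      proof (rule later[OF z(1) zB], rule indep_insert[OF _ i(1)])
        show "indep (B - {x})" using B by (rule indep_subset) blast
        show "(B - {x}) \<inter> block i = {}"
          using indep_block_unique[OF B i(1) x(1) T_block[OF i(2)]] by blast
        show "z \<in> T i" by (rule T_A[OF z(1) zB i(1) z(2)])
      qed
    next
      case False
      have "i \<in> blocks B" using i x T_block by (auto simp: blocks_def)
      \<comment> \<open>\<open>A\<close> misses \<open>block i\<close> but \<open>B\<close> meets
        it. As both meet equally many blocks, \<open>A\<close> meets one that \<open>B\<close>
        misses.\<close>
      have "\<not> blocks A \<subseteq> blocks B"
      proof
        assume "blocks A \<subseteq> blocks B"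
        then have "blocks A \<subset> blocks B" using False \<open>i \<in> blocks B\<close> by blast
        then have "card (blocks A) < card (blocks B)" by (intro psubset_card_mono finite_blocks)
        then show False using card card_blocks A B by simp
      qed
      then obtain l where l: "l \<in> {1..n}" "A \<inter> block l \<noteq> {}" "B \<inter> block l = {}"
        by (auto simp: blocks_def)
      then obtain z where z: "z \<in> A" "z \<in> block l" by blast
      then have zB: "z \<notin> B" using l by blast
      have "indep (insert z B)"
        by (rule indep_insert[OF B l(1,3) T_A[OF z(1) zB l(1) z(2)]])
      then have "indep (insert z (B - {x}))"
        by (rule indep_subset) blast
      then show ?thesis
        by (rule later[OF z(1) zB])
    qed
  qed
qed

end

section \<open>The multigraded shifts of a clique corona\<close>

locale corona_resolution = clique_corona V E n w T + graded_resolution "clique_corona.X V n T" I sh d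
  for V :: "'v set" and E n w T and I :: "('v, 'k::field) mpoly set" and sh d +
  assumes mem_iff: "Poly_Mapping.keys a \<subseteq> X \<Longrightarrow> x_mon a \<in> I \<longleftrightarrow> indep (X - Poly_Mapping.keys a)"
begin

text \<open>\<open>Q A S k\<close> says that the reduced homology in degree \<open>k - 1\<close> of the link of \<open>A\<close> in the independence
  complex, restricted to \<open>S\<close>, vanishes. In this reading the next lemmas are the deletion-link
  sequences.\<close>

definition Q :: "'v set \<Rightarrow> 'v set \<Rightarrow> nat \<Rightarrow> bool" where
  "Q A S k \<longleftrightarrow> exact (char_mon (X - A)) S k"

lemma finite_compl: "finite (X - A)"
  using finite_X by simp

lemma lookup_compl: "Poly_Mapping.lookup (char_mon (X - A)) v = (if v \<in> X - A then 1 else 0)"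
  by (rule lookup_char_mon[OF finite_compl])

lemma keys_compl: "Poly_Mapping.keys (char_mon (X - A)) \<subseteq> X"
  unfolding keys_char_mon[OF finite_compl] by blast

lemma mem_compl: "A \<subseteq> X \<Longrightarrow> x_mon (char_mon (X - A)) \<in> I \<longleftrightarrow> indep A"
  unfolding mem_iff[OF keys_compl] keys_char_mon[OF finite_compl] by (simp add: double_diff)

lemma decr_compl: "v \<in> X - A \<Longrightarrow> decr (char_mon (X - A)) v = char_mon (X - insert v A)"
  by (subst decr_char_mon[OF finite_compl]) (simp_all add: Diff_insert[symmetric])

lemma Q_insert_zero: "v \<in> A \<Longrightarrow> Q A (insert v S) k \<longleftrightarrow> Q A S k"
  unfolding Q_def by (simp add: slice_insert_zero lookup_compl)

lemma Q_rules:
  assumes "v \<notin> S" "v \<in> X - A"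
  shows Q_slice: "Q (insert v A) S k \<Longrightarrow> Q A (insert v S) k \<Longrightarrow> Q A S k"
    and Q_insert: "Q A S k \<Longrightarrow> (\<And>k'. k = Suc k' \<Longrightarrow> Q (insert v A) S k') \<Longrightarrow> Q A (insert v S) k"
    and Q_lower: "Q A (insert v S) (Suc k) \<Longrightarrow> Q A S k \<Longrightarrow> Q (insert v A) S k"
proof -
  have v: "v \<notin> S" "Poly_Mapping.lookup (char_mon (X - A)) v > 0"
    using assms by (simp_all add: lookup_compl)
  show "Q (insert v A) S k \<Longrightarrow> Q A (insert v S) k \<Longrightarrow> Q A S k"
    using exact_slice[OF v] unfolding Q_def decr_compl[OF assms(2)] by blast
  show "Q A S k \<Longrightarrow> (\<And>k'. k = Suc k' \<Longrightarrow> Q (insert v A) S k') \<Longrightarrow> Q A (insert v S) k"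
    using exact_insert[OF v] unfolding Q_def decr_compl[OF assms(2)] by blast
  show "Q A (insert v S) (Suc k) \<Longrightarrow> Q A S k \<Longrightarrow> Q (insert v A) S k"
    using exact_lower[OF v] unfolding Q_def decr_compl[OF assms(2)] by blast
qed

lemma Q_not_indep:
  assumes "A \<subseteq> X" "\<not> indep A" "finite S"
  shows "Q A S k"
  unfolding Q_def using assms mem_compl by (intro exact_notin keys_compl) auto

text \<open>All slices of the dependent set \<open>insert v A\<close> are acyclic, so the exact
  sequence transfers exactness both ways.\<close>

lemma Q_insert_dependent:
  assumes "indep A" "v \<in> X" "\<not> indep (insert v A)" "v \<notin> S" "finite S"
  shows "Q A (insert v S) k \<longleftrightarrow> Q A S k"
proof (cases "v \<in> A")
  case False
  have "Q (insert v A) S l" for l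
    using assms by (intro Q_not_indep) (auto simp: indep_def)
  then show ?thesis
    using Q_slice[of v S A k] Q_insert[of v S A k] assms False by blast
qed (simp add: Q_insert_zero)

text \<open>An independent set with \<open>n\<close> elements cannot be enlarged, so adding vertices
  to \<open>S\<close> changes nothing. For empty \<open>S\<close> the homology is the ideal in a
  single degree, sitting at the bottom.\<close>

lemma Q_facet:
  assumes "indep A" "card A = n" "finite S" "S \<subseteq> X"
  shows "Q A S k \<longleftrightarrow> k \<noteq> 0"
  using assms(3,4)
proof (induction S)
  case empty
  have "A \<subseteq> X" using assms by (simp add: indep_def)
  then show ?case
    using exact_below_Suc[OF keys_compl] exact_below_zero[OF keys_compl] mem_compl assms(1)
    by (cases k) (auto simp: Q_def)
next
  case (insert v S)
  show ?case
  proof (cases "v \<in> A")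
    case False
    have "\<not> indep (insert v A)"
      using card_indep_le[of "insert v A"] False assms indep_finite by auto
    then show ?thesis
      using insert assms by (subst Q_insert_dependent) auto
  qed (use insert in \<open>simp add: Q_insert_zero\<close>)
qed

text \<open>The neighbours of \<open>y i\<close> all lie in \<open>block i\<close>, which is
  disjoint from \<open>A\<close> and from the other chosen vertices. So \<open>y i\<close> is a cone
  point.\<close>

lemma Q_cone:
  assumes A: "indep A" "i \<in> {1..n}" "A \<inter> block i = {}"
    and y: "\<And>i. i \<in> {1..n} \<Longrightarrow> y i \<in> T i"
  shows "Q A (y ` {1..n}) k"
proof -
  let ?S = "y ` ({1..n} - {i})"
  have y_block: "y j \<in> block j" if "j \<in> {1..n}" for j
    using y[OF that] by (rule T_block)
  have S_block: "?S \<inter> block i = {}"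
    using y_block block_disjoint[OF A(2)] by fastforce
  have yi: "y i \<in> X" "y i \<notin> A" "y i \<notin> ?S"
    using y[OF A(2)] T_sub_X[OF A(2)] y_block[OF A(2)] A(3) S_block by blast+
  have "exact (char_mon (X - A)) (insert (y i) ?S) k"
  proof (rule exact_cone)
    show "finite ?S" "y i \<notin> ?S" using yi by auto
    show "Poly_Mapping.keys (char_mon (X - A)) \<subseteq> X" by (rule keys_compl)
    show "0 < Poly_Mapping.lookup (char_mon (X - A)) (y i)" using yi by (simp add: lookup_compl)
    fix b assume b: "Poly_Mapping.keys b \<subseteq> X" "x_mon b \<in> I"
      "\<And>u. u \<notin> ?S \<Longrightarrow> Poly_Mapping.lookup b u = Poly_Mapping.lookup (char_mon (X - A)) u"
    define B where "B = X - Poly_Mapping.keys b"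
    have B: "indep B" using mem_iff[OF b(1)] b(2) by (simp add: B_def)
    \<comment> \<open>Outside \<open>?S\<close> the degree \<open>b\<close> has the same support as
      the complement of \<open>A\<close>, so \<open>B\<close> gains only vertices of
      \<open>?S\<close>.\<close>
    have "B \<subseteq> A \<union> ?S"
      using b(3) by (auto simp: B_def in_keys_iff lookup_compl split: if_splits)
    then have "B \<inter> block i = {}"
      using A(3) S_block by blast
    then have "indep (insert (y i) B)"
      by (rule indep_insert[OF B A(2) _ y[OF A(2)]])
    then have "indep (X - Poly_Mapping.keys (decr b (y i)))"
      by (rule indep_subset) (auto simp: B_def in_keys_iff lookup_decr split: if_splits)
    then show "x_mon (decr b (y i)) \<in> I"
      using mem_iff[OF keys_decr[OF b(1)]] by simp
  qed
  moreover have "insert (y i) ?S = y ` {1..n}" using A(2) by blast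
  ultimately show ?thesis by (simp add: Q_def)
qed

text \<open>If \<open>S\<close> consists of the chosen vertices \<open>y i\<close> alone,
  \<open>Q_facet\<close> or \<open>Q_cone\<close> applies. A further vertex brings in a set with one
  more element at an index one lower, so a pair off the diagonal \<open>k = n - card A\<close> stays
  off it.\<close>

lemma Q_off_diagonal:
  assumes y: "\<And>i. i \<in> {1..n} \<Longrightarrow> y i \<in> T i"
    and S: "y ` {1..n} \<subseteq> S" "S \<subseteq> X" and A: "indep A" "k \<noteq> n - card A"
  shows "Q A S k"
proof -
  let ?Y = "y ` {1..n}"
  have Y: "?Y \<subseteq> X" using y T_sub_X by blast
  have "Q A (?Y \<union> R) k" if "finite R" "R \<subseteq> X - ?Y" "indep A" "k \<noteq> n - card A" for R A k
    using that
  proof (induction R arbitrary: A k rule: finite_induct)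
    case (empty A k)
    show ?case
    proof (cases "card A = n")
      case True
      then show ?thesis using empty Y by (simp add: Q_facet)
    next
      case False
      then have "card A < n" using card_indep_le empty by (simp add: le_neq_implies_less)
      then obtain i where "i \<in> {1..n}" "A \<inter> block i = {}" using missed_block empty by blast
      then show ?thesis using Q_cone[of A i y k] y empty by simp
    qed
  next
    case (insert v R A k)
    have IH: "Q A' (?Y \<union> R) k'" if "indep A'" "k' \<noteq> n - card A'" for A' k'
      using insert that by blast
    have v: "v \<notin> ?Y \<union> R" "v \<in> X" using insert by auto
    have "Q A (insert v (?Y \<union> R)) k"
    proof (cases "v \<in> A")
      case True
      then show ?thesis using IH insert.prems by (simp add: Q_insert_zero)
    next
      case vA: False
      show ?thesis
      proof (cases "indep (insert v A)")
        case True
        have "card (insert v A) = Suc (card A)"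
          using vA indep_finite insert.prems by simp
        then have "k' \<noteq> n - card (insert v A)" if "k = Suc k'" for k'
          using that insert.prems card_indep_le[OF True] by auto
        then show ?thesis
          using v vA IH insert.prems True by (intro Q_insert) auto
      next
        case False
        have "Q A (insert v (?Y \<union> R)) k \<longleftrightarrow> Q A (?Y \<union> R) k"
          using v False insert.prems insert.hyps by (intro Q_insert_dependent) auto
        then show ?thesis using IH insert.prems by blast
      qed
    qed
    then show ?case by simp
  qed
  moreover have "finite (S - ?Y)" "S - ?Y \<subseteq> X - ?Y" "?Y \<union> (S - ?Y) = S"
    using S finite_X finite_subset by blast+
  ultimately show ?thesis using A by metis
qed

text \<open>Induction on the number \<open>k\<close> of blocks that \<open>A\<close> misses. Once
  the second vertex \<open>z i\<close> of a missed block is taken out of \<open>S\<close>,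
  \<open>Q_off_diagonal\<close> still applies to \<open>A\<close> at \<open>k\<close>, since all
  \<open>y i\<close> remain. Exactness for \<open>S\<close> at \<open>Suc k\<close> would then, by
  \<open>Q_lower\<close>, contradict the induction hypothesis for
  \<open>insert (z i) A\<close>.\<close>

lemma Q_diagonal:
  assumes y: "\<And>i. i \<in> {1..n} \<Longrightarrow> y i \<in> T i" and z: "\<And>i. i \<in> {1..n} \<Longrightarrow> z i \<in> T i"
    and yz: "\<And>i. i \<in> {1..n} \<Longrightarrow> y i \<noteq> z i"
    and "y ` {1..n} \<subseteq> S" "S \<subseteq> X" "indep A" "card A + k = n"
    and "\<And>i. i \<in> {1..n} \<Longrightarrow> A \<inter> block i = {} \<Longrightarrow> z i \<in> S"
  shows "\<not> Q A S k"
  using assms(4-)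
proof (induction k arbitrary: A S)
  case 0
  then show ?case
    using Q_facet[of A S 0] finite_subset[OF _ finite_X] by simp
next
  case (Suc k)
  then have "card A < n" by simp
  then obtain i where i: "i \<in> {1..n}" "A \<inter> block i = {}"
    using missed_block[OF Suc.prems(3)] by blast
  have zi: "z i \<in> S" "z i \<in> block i" "z i \<notin> A" "z i \<in> X"
    using Suc.prems(2,5) i T_block[OF z[OF i(1)]] by blast+
  have neq: "z i \<noteq> y j" "i \<noteq> j \<Longrightarrow> z i \<noteq> z j" if "j \<in> {1..n}" for j
    using yz[OF i(1)] block_disjoint[OF i(1) that zi(2)] T_block[OF y[OF that]] T_block[OF z[OF that]]
    by auto
  have indep: "indep (insert (z i) A)"
    using i z Suc.prems by (intro indep_insert) auto
  have Y: "y ` {1..n} \<subseteq> S - {z i}"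
    using Suc.prems(1) neq by fastforce
  have "\<not> Q (insert (z i) A) (S - {z i}) k"
  proof (rule Suc.IH)
    show "y ` {1..n} \<subseteq> S - {z i}" by (rule Y)
    show "S - {z i} \<subseteq> X" "indep (insert (z i) A)" using Suc.prems indep by auto
    show "card (insert (z i) A) + k = n"
      using zi Suc.prems indep_finite by simp
    fix j assume j: "j \<in> {1..n}" "insert (z i) A \<inter> block j = {}"
    then have "i \<noteq> j" using zi by blast
    then show "z j \<in> S - {z i}" using j(2) neq(2)[OF j(1)] Suc.prems(5)[OF j(1)] by auto
  qed
  moreover have "Q A (S - {z i}) k"
  proof (rule Q_off_diagonal[OF y Y])
    show "S - {z i} \<subseteq> X" "indep A" using Suc.prems by auto
    show "k \<noteq> n - card A" using Suc.prems(4) by simp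
  qed
  ultimately show ?case
    using Q_lower[of "z i" "S - {z i}" A k] zi by (auto simp: insert_absorb)
qed

theorem shifts_eq: "set (sh k) = {char_mon (X - A) | A. indep A \<and> card A + k = n}"
proof -
  have "\<exists>y z. y \<in> T i \<and> z \<in> T i \<and> y \<noteq> z" if "i \<in> {1..n}" for i
    using card_T[OF that] by (auto simp: numeral_2_eq_2 card_le_Suc_iff)
  then obtain y z where yz: "\<And>i. i \<in> {1..n} \<Longrightarrow> y i \<in> T i" "\<And>i. i \<in> {1..n} \<Longrightarrow> z i \<in> T i"
    "\<And>i. i \<in> {1..n} \<Longrightarrow> y i \<noteq> z i"
    by metis
  have subsets: "y ` {1..n} \<subseteq> X" "\<And>i. i \<in> {1..n} \<Longrightarrow> z i \<in> X"
    using yz T_sub_X by blast+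
  have "char_mon (X - A) \<in> set (sh k)" if "indep A" "card A + k = n" for A
    using Q_diagonal[OF yz, of X A k] subsets that exact_iff_not_shift[OF keys_compl, of A k]
    by (auto simp: Q_def)
  \<comment> \<open>Conversely, the full slice at a shift \<open>a\<close> is not exact, so
    \<open>a\<close> lies in the ideal. Cone points force it to be squarefree, and
    \<open>Q_off_diagonal\<close> fixes the size of \<open>A\<close>.\<close>
  moreover have "\<exists>A. a = char_mon (X - A) \<and> indep A \<and> card A + k = n" if a: "a \<in> set (sh k)" for a
  proof -
    have keys: "Poly_Mapping.keys a \<subseteq> X"
      using a keys_sh by (auto simp: in_set_conv_nth)
    then have not_exact: "\<not> exact a X k"
      using a exact_iff_not_shift by blast
    then have "x_mon a \<in> I"
      using exact_notin[OF finite_X keys] by blast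
    define A where "A = X - Poly_Mapping.keys a"
    have A: "indep A"
      using mem_iff[OF keys] \<open>x_mon a \<in> I\<close> by (simp add: A_def)
    \<comment> \<open>If the exponent of \<open>v\<close> is at least \<open>2\<close>, dividing by
      \<open>v\<close> keeps the support and hence membership, which would make \<open>v\<close> a
      cone point.\<close>
    have le1: "Poly_Mapping.lookup a v \<le> 1" for v
    proof (rule ccontr)
      assume v: "\<not> Poly_Mapping.lookup a v \<le> 1"
      then have vX: "v \<in> X" using keys by (auto simp: in_keys_iff)
      have "exact a (insert v (X - {v})) k"
      proof (rule exact_cone)
        fix b assume b: "Poly_Mapping.keys b \<subseteq> X" "x_mon b \<in> I"
          "\<And>u. u \<notin> X - {v} \<Longrightarrow> Poly_Mapping.lookup b u = Poly_Mapping.lookup a u"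
        have "Poly_Mapping.keys (decr b v) = Poly_Mapping.keys b"
          using b(3)[of v] v by (auto simp: in_keys_iff lookup_decr split: if_splits)
        then show "x_mon (decr b v) \<in> I"
          using mem_iff[OF b(1)] mem_iff[of "decr b v"] b by simp
      qed (use finite_X keys v in auto)
      then show False using not_exact vX by (simp add: insert_absorb)
    qed
    have "a = char_mon (X - A)"
    proof (rule poly_mapping_eqI)
      fix v
      show "Poly_Mapping.lookup a v = Poly_Mapping.lookup (char_mon (X - A)) v"
        using le1[of v] keys by (auto simp: lookup_compl A_def in_keys_iff)
    qed
    moreover have "card A + k = n"
    proof (rule ccontr)
      assume "\<not> ?thesis"
      then have "k \<noteq> n - card A" using card_indep_le[OF A] by simp
      then have "Q A X k" using yz subsets A by (intro Q_off_diagonal[of y]) auto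
      then show False using not_exact calculation by (simp add: Q_def)
    qed
    ultimately show ?thesis using A by blast
  qed
  ultimately show ?thesis by blast
qed

end

section \<open>Exchange property and linear quotients\<close>

lemma mon_dvd_single: "mon_dvd (Poly_Mapping.single x 1) m \<longleftrightarrow> x \<in> Poly_Mapping.keys m"
  by (auto simp: mon_dvd_def lookup_single_if in_keys_iff Suc_le_eq)

lemma x_var_eq: "x_var v = x_mon (Poly_Mapping.single v 1)"
  by (simp add: x_var_def x_mon_def)

lemma keys_times_x_mon:
  fixes p :: "('v, 'k::field) mpoly"
  shows "Poly_Mapping.keys (p * x_mon v) = (\<lambda>m. v + m) ` Poly_Mapping.keys p"
proof -
  have eq: "p * x_mon v = Poly_Mapping.single v 1 * p"
    by (simp add: x_mon_def mult.commute)
  have "m \<in> Poly_Mapping.keys (p * x_mon v) \<longleftrightarrow> m \<in> (\<lambda>m. v + m) ` Poly_Mapping.keys p" for m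
  proof (cases "mon_dvd v m")
    case True
    then obtain l where l: "m = v + l" using mon_dvd_diff[OF True] by metis
    have "m \<in> Poly_Mapping.keys (p * x_mon v) \<longleftrightarrow> l \<in> Poly_Mapping.keys p"
      unfolding eq l in_keys_iff lookup_single_times(1) by simp
    then show ?thesis
      unfolding l by auto
  next
    case False
    then have "m \<notin> Poly_Mapping.keys (p * x_mon v)"
      unfolding eq in_keys_iff by (simp add: lookup_single_times(2))
    then show ?thesis
      using False mon_dvd_add by auto
  qed
  then show ?thesis by blast
qed

text \<open>\<open>antichain\<close> makes \<open>M\<close> the set of minimal generators of its
  ideal, so that weak polymatroidality can be stated on exponents alone.\<close>

locale exchange_family =
  fixes X :: "'v set" and M :: "'v mon set" and xs :: "'v list"
  assumes finite_M: "finite M" and keys_M: "a \<in> M \<Longrightarrow> Poly_Mapping.keys a \<subseteq> X"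
    and antichain: "a \<in> M \<Longrightarrow> b \<in> M \<Longrightarrow> mon_dvd a b \<Longrightarrow> a = b"
    and xs: "distinct xs" "set xs = X"
    and exchange: "u \<in> M \<Longrightarrow> v \<in> M \<Longrightarrow> t < length xs \<Longrightarrow>
      (\<And>i. i < t \<Longrightarrow> Poly_Mapping.lookup u (xs ! i) = Poly_Mapping.lookup v (xs ! i)) \<Longrightarrow>
      Poly_Mapping.lookup u (xs ! t) > Poly_Mapping.lookup v (xs ! t) \<Longrightarrow>
      \<exists>j. t < j \<and> j < length xs \<and> Poly_Mapping.lookup v (xs ! j) > 0 \<and>
        Poly_Mapping.single (xs ! t) 1 + (v - Poly_Mapping.single (xs ! j) 1) \<in> M"
begin

lemma x_mon_mem: "(x_mon m :: ('v, 'k::field) mpoly) \<in> Idl\<^bsub>poly_ring X\<^esub> (x_mon ` M) \<longleftrightarrow>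
    Poly_Mapping.keys m \<subseteq> X \<and> (\<exists>s\<in>M. mon_dvd s m)"
  by (rule x_mon_mem_Idl[OF keys_M])

lemma min_gens_eq: "min_gens (Idl\<^bsub>poly_ring X\<^esub> (x_mon ` M) :: ('v, 'k::field) mpoly set) = M"
proof (intro Set.set_eqI iffI)
  fix a assume "a \<in> min_gens (Idl\<^bsub>poly_ring X\<^esub> (x_mon ` M) :: ('v, 'k) mpoly set)"
  then have a: "(x_mon a :: ('v, 'k) mpoly) \<in> Idl\<^bsub>poly_ring X\<^esub> (x_mon ` M)"
    "\<And>b. (x_mon b :: ('v, 'k) mpoly) \<in> Idl\<^bsub>poly_ring X\<^esub> (x_mon ` M) \<Longrightarrow> mon_dvd b a \<Longrightarrow> b = a"
    by (auto simp: min_gens_def)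
  then obtain s where s: "s \<in> M" "mon_dvd s a" by (auto simp: x_mon_mem)
  have "(x_mon s :: ('v, 'k) mpoly) \<in> Idl\<^bsub>poly_ring X\<^esub> (x_mon ` M)"
    unfolding x_mon_mem using s(1) keys_M mon_dvd_refl by blast
  then have "s = a" using a(2) s(2) by simp
  then show "a \<in> M" using s(1) by simp
next
  fix a assume a: "a \<in> M"
  have "b = a" if b: "(x_mon b :: ('v, 'k) mpoly) \<in> Idl\<^bsub>poly_ring X\<^esub> (x_mon ` M)" "mon_dvd b a" for b
  proof -
    obtain s where s: "s \<in> M" "mon_dvd s b" using b(1) by (auto simp: x_mon_mem)
    have "s = a" using antichain[OF s(1) a] mon_dvd_trans[OF s(2) b(2)] by simp
    then show ?thesis using mon_dvd_antisym[OF b(2)] s(2) by simp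
  qed
  moreover have "(x_mon a :: ('v, 'k) mpoly) \<in> Idl\<^bsub>poly_ring X\<^esub> (x_mon ` M)"
    unfolding x_mon_mem using a keys_M mon_dvd_refl by blast
  ultimately show "a \<in> min_gens (Idl\<^bsub>poly_ring X\<^esub> (x_mon ` M) :: ('v, 'k) mpoly set)"
    by (simp add: min_gens_def)
qed

lemma monomial_ideal_M: "monomial_ideal X (Idl\<^bsub>poly_ring X\<^esub> (x_mon ` M) :: ('v, 'k::field) mpoly set)"
  unfolding monomial_ideal_def using keys_M by blast

theorem weakly_polymatroidal:
  "weakly_polymatroidal X (Idl\<^bsub>poly_ring X\<^esub> (x_mon ` M) :: ('v, 'k::field) mpoly set)"
  unfolding weakly_polymatroidal_def weakly_polymatroidal_wrt_def min_gens_eq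
  using monomial_ideal_M xs exchange by (intro conjI exI[of _ xs]) auto

text \<open>The order on lists is lexicographic, so comparing these lists of equal length compares
  monomials with respect to the variable order \<open>xs\<close>.\<close>

definition exponents :: "'v mon \<Rightarrow> nat list" where
  "exponents a = map (Poly_Mapping.lookup a) xs"

lemma exponents_less:
  "exponents a < exponents b \<longleftrightarrow> (\<exists>t<length xs.
     (\<forall>i<t. Poly_Mapping.lookup b (xs ! i) = Poly_Mapping.lookup a (xs ! i)) \<and>
     Poly_Mapping.lookup a (xs ! t) < Poly_Mapping.lookup b (xs ! t))"
proof -
  have "take t (exponents a) = take t (exponents b) \<longleftrightarrow>
      (\<forall>i<t. Poly_Mapping.lookup b (xs ! i) = Poly_Mapping.lookup a (xs ! i))" if "t < length xs" for t
    using that by (auto simp: exponents_def list_eq_iff_nth_eq)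
  then show ?thesis
    unfolding list_less_def lexord_take_index_conv by (auto simp: exponents_def)
qed

lemma inj_exponents: "inj_on exponents M"
proof (rule inj_onI)
  fix a b assume ab: "a \<in> M" "b \<in> M" "exponents a = exponents b"
  show "a = b"
  proof (rule poly_mapping_eqI)
    fix v
    show "Poly_Mapping.lookup a v = Poly_Mapping.lookup b v"
    proof (cases "v \<in> X")
      case True
      then show ?thesis using ab(3) xs(2) by (auto simp: exponents_def)
    next
      case False
      then have "v \<notin> Poly_Mapping.keys a" "v \<notin> Poly_Mapping.keys b"
        using keys_M ab by blast+
      then show ?thesis by (simp add: in_keys_iff)
    qed
  qed
qed

text \<open>Suppose an earlier generator \<open>s\<close> divides \<open>v + m\<close>. Exchange at
  the first position \<open>t\<close> where \<open>s\<close> and \<open>v\<close> differ yields an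
  earlier generator dividing the product of \<open>v\<close> and \<open>xs ! t\<close>, and
  \<open>xs ! t\<close> divides \<open>m\<close>. So variables generate the colon ideal.\<close>

theorem linear_quotients:
  "linear_quotients X (Idl\<^bsub>poly_ring X\<^esub> (x_mon ` M) :: ('v, 'k::field) mpoly set)"
proof -
  obtain l where l: "set l = M" "distinct l"
    using finite_distinct_list[OF finite_M] by blast
  define ms where "ms = rev (sort_key exponents l)"
  have set_ms: "set ms = M" and distinct_ms: "distinct ms"
    using l by (simp_all add: ms_def)
  have "sorted_wrt (<) (map exponents (sort_key exponents l))"
    using inj_exponents l by (simp add: strict_sorted_iff distinct_map)
  then have "sorted_wrt (\<lambda>a b. exponents b < exponents a) ms"
    by (simp add: ms_def sorted_wrt_rev sorted_wrt_map)
  then have decreasing: "exponents (ms ! j) < exponents (ms ! i)" if "i < j" "j < length ms" for i j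
    using that by (simp add: sorted_wrt_iff_nth_less)
  have "\<exists>Y\<subseteq>X. colon_ideal X (Idl\<^bsub>poly_ring X\<^esub> (x_mon ` set (take j ms))) (x_mon (ms ! j))
      = (Idl\<^bsub>poly_ring X\<^esub> (x_var ` Y) :: ('v, 'k) mpoly set)" if j: "j < length ms" for j
  proof -
    define v where "v = ms ! j"
    define P where "P = set (take j ms)"
    define Y where "Y = {x \<in> X. \<exists>s\<in>P. mon_dvd s (v + Poly_Mapping.single x 1)}"
    have v: "v \<in> M" using j set_ms by (auto simp: v_def)
    have P_M: "P \<subseteq> M" unfolding P_def using set_ms set_take_subset by fastforce
    have P_iff: "s \<in> P \<longleftrightarrow> s \<in> M \<and> exponents v < exponents s" for s
    proof
      assume s: "s \<in> P"
      then obtain i where "i < j" "s = ms ! i" using j by (auto simp: P_def in_set_conv_nth)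
      then show "s \<in> M \<and> exponents v < exponents s" using s P_M decreasing[of i j] j by (auto simp: v_def)
    next
      assume s: "s \<in> M \<and> exponents v < exponents s"
      then obtain i where i: "i < length ms" "s = ms ! i"
        using set_ms by (auto simp: in_set_conv_nth)
      have "i < j"
        using s decreasing[of j i] i by (metis linorder_neqE_nat order_less_asym order_less_irrefl v_def)
      then show "s \<in> P"
        using i j by (auto simp: P_def in_set_conv_nth)
    qed
    have colon: "(\<exists>s\<in>P. mon_dvd s (v + m)) \<longleftrightarrow> (\<exists>x\<in>Y. x \<in> Poly_Mapping.keys m)" for m
    proof
      assume "\<exists>s\<in>P. mon_dvd s (v + m)"
      then obtain s where s: "s \<in> P" "mon_dvd s (v + m)" by blast
      then obtain t where t: "t < length xs"
        "\<And>i. i < t \<Longrightarrow> Poly_Mapping.lookup s (xs ! i) = Poly_Mapping.lookup v (xs ! i)"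
        "Poly_Mapping.lookup v (xs ! t) < Poly_Mapping.lookup s (xs ! t)"
        unfolding P_iff exponents_less by blast
      then obtain l where l: "t < l" "l < length xs" "Poly_Mapping.lookup v (xs ! l) > 0"
        "Poly_Mapping.single (xs ! t) 1 + (v - Poly_Mapping.single (xs ! l) 1) \<in> M"
        using exchange[of s v t] s P_M v by blast
      define s' where "s' = Poly_Mapping.single (xs ! t) 1 + (v - Poly_Mapping.single (xs ! l) 1)"
      have neq: "xs ! t \<noteq> xs ! i" if "i < length xs" "t \<noteq> i" for i
        using that t xs(1) by (simp add: nth_eq_iff_index_eq)
      have neq': "xs ! l \<noteq> xs ! i" if "i < t" for i
        using that t l xs(1) by (simp add: nth_eq_iff_index_eq)
      have "exponents v < exponents s'"
        unfolding exponents_less s'_def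
      proof (intro exI[of _ t] conjI allI impI)
        fix i assume i: "i < t"
        then show "Poly_Mapping.lookup (Poly_Mapping.single (xs ! t) 1 + (v - Poly_Mapping.single (xs ! l) 1)) (xs ! i)
            = Poly_Mapping.lookup v (xs ! i)"
          using neq[of i] neq'[of i] t(1) by (auto simp: lookup_add lookup_minus lookup_single_if)
      qed (use t l neq[of l] in \<open>auto simp: lookup_add lookup_minus lookup_single_if\<close>)
      then have "s' \<in> P" using l(4) by (simp add: P_iff s'_def)
      moreover have "mon_dvd s' (v + Poly_Mapping.single (xs ! t) 1)"
        by (simp add: mon_dvd_def s'_def lookup_add lookup_minus)
      ultimately have "xs ! t \<in> Y"
        using t xs(2) by (auto simp: Y_def)
      moreover have "xs ! t \<in> Poly_Mapping.keys m"
      proof -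
        have "Poly_Mapping.lookup s (xs ! t) \<le> Poly_Mapping.lookup (v + m) (xs ! t)"
          using s(2) by (simp add: mon_dvd_def)
        then show ?thesis using t(3) by (simp add: lookup_add in_keys_iff)
      qed
      ultimately show "\<exists>x\<in>Y. x \<in> Poly_Mapping.keys m" by blast
    next
      assume "\<exists>x\<in>Y. x \<in> Poly_Mapping.keys m"
      then obtain x s where x: "x \<in> Poly_Mapping.keys m" "s \<in> P" "mon_dvd s (v + Poly_Mapping.single x 1)"
        by (auto simp: Y_def)
      have "mon_dvd (v + Poly_Mapping.single x 1) (v + m)"
        using x(1) by (simp add: mon_dvd_def lookup_add lookup_single_if in_keys_iff Suc_le_eq)
      then show "\<exists>s\<in>P. mon_dvd s (v + m)"
        using x mon_dvd_trans by blast
    qed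
    have keys_P: "Poly_Mapping.keys a \<subseteq> X" if "a \<in> P" for a
      using that P_M keys_M by blast
    have keys_Y: "Poly_Mapping.keys a \<subseteq> X" if "a \<in> (\<lambda>x. Poly_Mapping.single x 1) ` Y" for a :: "'v mon"
      using that by (auto simp: Y_def)
    have img: "(x_var ` Y :: ('v, 'k) mpoly set) = x_mon ` (\<lambda>x. Poly_Mapping.single x 1) ` Y"
      by (simp add: image_image x_var_eq)
    have mem_P: "p \<in> Idl\<^bsub>poly_ring X\<^esub> (x_mon ` P) \<longleftrightarrow>
        p \<in> carrier (poly_ring X) \<and> (\<forall>m\<in>Poly_Mapping.keys p. \<exists>s\<in>P. mon_dvd s m)"
      for p :: "('v, 'k) mpoly"
      by (rule mem_Idl_monomials) (rule keys_P)
    have mem_Y: "p \<in> Idl\<^bsub>poly_ring X\<^esub> (x_var ` Y) \<longleftrightarrow>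
        p \<in> carrier (poly_ring X) \<and> (\<forall>m\<in>Poly_Mapping.keys p. \<exists>x\<in>Y. x \<in> Poly_Mapping.keys m)"
      for p :: "('v, 'k) mpoly"
      unfolding img by (subst mem_Idl_monomials, erule keys_Y) (simp only: bex_simps mon_dvd_single)
    have "p \<in> colon_ideal X (Idl\<^bsub>poly_ring X\<^esub> (x_mon ` P)) (x_mon v) \<longleftrightarrow>
        p \<in> Idl\<^bsub>poly_ring X\<^esub> (x_var ` Y)" for p :: "('v, 'k) mpoly"
    proof -
      have "p * x_mon v \<in> carrier (poly_ring X)" if "p \<in> carrier (poly_ring X)"
        using that keys_M[OF v] by (auto simp: carrier_poly_ring keys_times_x_mon keys_add_mon)
      then have "p \<in> colon_ideal X (Idl\<^bsub>poly_ring X\<^esub> (x_mon ` P)) (x_mon v) \<longleftrightarrow>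
          p \<in> carrier (poly_ring X) \<and> (\<forall>m\<in>Poly_Mapping.keys p. \<exists>s\<in>P. mon_dvd s (v + m))"
        unfolding colon_ideal_def mem_P keys_times_x_mon by auto
      then show ?thesis
        unfolding mem_Y colon .
    qed
    then have "colon_ideal X (Idl\<^bsub>poly_ring X\<^esub> (x_mon ` P)) (x_mon v)
        = (Idl\<^bsub>poly_ring X\<^esub> (x_var ` Y) :: ('v, 'k) mpoly set)"
      by blast
    then show ?thesis
      unfolding P_def v_def by (intro exI[of _ Y]) (auto simp: Y_def)
  qed
  then show ?thesis
    unfolding linear_quotients_def min_gens_eq using monomial_ideal_M set_ms distinct_ms by blast
qed

end

section \<open>Monomials in a vertex cover ideal\<close>

lemma mon_dvd_char_mon: "finite C \<Longrightarrow> mon_dvd (char_mon C) a \<longleftrightarrow> C \<subseteq> Poly_Mapping.keys a"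
  by (auto simp: mon_dvd_def lookup_char_mon in_keys_iff Suc_le_eq)

lemma prod_x_var: "finite C \<Longrightarrow> (\<Prod>v\<in>C. x_var v) = (x_mon (char_mon C) :: ('v, 'k::field) mpoly)"
proof (induction C rule: finite_induct)
  case (insert v C)
  then show ?case by (simp add: x_var_eq x_mon_mult char_mon_def)
qed (simp add: x_mon_def char_mon_def)

lemma minimal_vertex_cover_exists:
  assumes "finite V" "vertex_cover V E C"
  shows "\<exists>D\<subseteq>C. minimal_vertex_cover V E D"
proof -
  have "finite {D. vertex_cover V E D}"
    using assms(1) by (rule finite_subset[rotated, OF finite_Pow_iff[THEN iffD2]]) (auto simp: vertex_cover_def)
  from finite_has_minimal2[OF this, of C] assms(2)
  obtain D where "vertex_cover V E D" "D \<subseteq> C" "\<And>D'. vertex_cover V E D' \<Longrightarrow> D' \<subseteq> D \<Longrightarrow> D = D'"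
    by auto
  then show ?thesis
    unfolding minimal_vertex_cover_def by (metis psubset_eq)
qed

text \<open>A set of vertices contains a minimal cover exactly if it is itself a cover, and
  divisibility by a squarefree generator depends only on the support.\<close>

theorem x_mon_mem_vertex_cover_ideal:
  assumes "finite V"
  shows "(x_mon a :: ('v, 'k::field) mpoly) \<in> vertex_cover_ideal V E \<longleftrightarrow>
    Poly_Mapping.keys a \<subseteq> V \<and> vertex_cover V E (Poly_Mapping.keys a)"
proof -
  have fin: "finite C" if "minimal_vertex_cover V E C" for C
    using that assms finite_subset by (auto simp: minimal_vertex_cover_def vertex_cover_def)
  have "{\<Prod>v\<in>C. x_var v | C. minimal_vertex_cover V E C} =
      ((\<lambda>C. \<Prod>v\<in>C. x_var v) ` {C. minimal_vertex_cover V E C} :: ('v, 'k) mpoly set)"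
    by (rule setcompr_eq_image)
  also have "\<dots> = x_mon ` char_mon ` {C. minimal_vertex_cover V E C}"
    unfolding image_image by (rule image_cong) (simp_all add: prod_x_var fin)
  finally have "(x_mon a :: ('v, 'k) mpoly) \<in> vertex_cover_ideal V E \<longleftrightarrow>
      (x_mon a :: ('v, 'k) mpoly) \<in> Idl\<^bsub>poly_ring V\<^esub> (x_mon ` char_mon ` {C. minimal_vertex_cover V E C})"
    by (simp add: vertex_cover_ideal_def)
  also have "\<dots> \<longleftrightarrow> Poly_Mapping.keys a \<subseteq> V \<and>
      (\<exists>s\<in>char_mon ` {C. minimal_vertex_cover V E C}. mon_dvd s a)"
  proof (rule x_mon_mem_Idl)
    fix s assume "s \<in> char_mon ` {C. minimal_vertex_cover V E C}"
    then obtain C where C: "s = char_mon C" "minimal_vertex_cover V E C" by blast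
    then show "Poly_Mapping.keys s \<subseteq> V"
      using keys_char_mon[OF fin[OF C(2)]] by (simp add: minimal_vertex_cover_def vertex_cover_def)
  qed
  also have "\<dots> \<longleftrightarrow> Poly_Mapping.keys a \<subseteq> V \<and> vertex_cover V E (Poly_Mapping.keys a)"
  proof (rule conj_cong[OF refl])
    assume a: "Poly_Mapping.keys a \<subseteq> V"
    have "(\<exists>s\<in>char_mon ` {C. minimal_vertex_cover V E C}. mon_dvd s a) \<longleftrightarrow>
        (\<exists>C. minimal_vertex_cover V E C \<and> C \<subseteq> Poly_Mapping.keys a)"
      using mon_dvd_char_mon[OF fin] by (simp add: conj_commute cong: conj_cong)
    also have "\<dots> \<longleftrightarrow> vertex_cover V E (Poly_Mapping.keys a)"
    proof
      assume "\<exists>C. minimal_vertex_cover V E C \<and> C \<subseteq> Poly_Mapping.keys a"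
      then obtain C where "vertex_cover V E C" "C \<subseteq> Poly_Mapping.keys a"
        unfolding minimal_vertex_cover_def by blast
      then show "vertex_cover V E (Poly_Mapping.keys a)"
        using a unfolding vertex_cover_def by blast
    qed (use minimal_vertex_cover_exists[OF assms] in blast)
    finally show "(\<exists>s\<in>char_mon ` {C. minimal_vertex_cover V E C}. mon_dvd s a) \<longleftrightarrow>
        vertex_cover V E (Poly_Mapping.keys a)" .
  qed
  finally show ?thesis .
qed

lemma ideal_vertex_cover_ideal:
  assumes "finite V"
  shows "ideal (vertex_cover_ideal V E) (poly_ring V :: ('v, 'k::field) mpoly ring)"
proof -
  interpret cring "poly_ring V :: ('v, 'k) mpoly ring" by (rule cring_poly_ring)
  have "(\<Prod>v\<in>C. x_var v :: ('v, 'k) mpoly) \<in> carrier (poly_ring V)" if "minimal_vertex_cover V E C" for C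
  proof -
    have C: "C \<subseteq> V" using that by (simp add: minimal_vertex_cover_def vertex_cover_def)
    then have "finite C" using assms finite_subset by blast
    then show ?thesis
      using C by (simp add: prod_x_var x_mon_def single_in_carrier keys_char_mon)
  qed
  then show ?thesis
    unfolding vertex_cover_ideal_def by (intro genideal_ideal) auto
qed

section \<open>Application to the vertex cover ideal of the corona\<close>

context clique_corona
begin

lemma vertex_cover_iff_indep:
  assumes "B \<subseteq> X"
  shows "vertex_cover X (corona_edges E n w T) B \<longleftrightarrow> indep (X - B)"
proof -
  have "e \<subseteq> X" if e: "e \<in> corona_edges E n w T" for e
  proof -
    consider "e \<in> E" | i where "i \<in> {1..n}" "e \<in> complete_edges (T i)"
      | i x where "i \<in> {1..n}" "x \<in> T i" "e = {w i, x}"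
      using e by (auto simp: corona_edges_def)
    then show ?thesis
    proof cases
      case 1
      then show ?thesis using edge_sub_V[of e] V_sub_X by blast
    next
      case (2 i)
      then show ?thesis using T_sub_X[of i] by (auto simp: complete_edges_def)
    next
      case (3 i x)
      have "w i \<in> X" using 3(1) V_sub_X unfolding V_eq by blast
      then show ?thesis using 3 T_sub_X[of i] by auto
    qed
  qed
  then have "B \<inter> e \<noteq> {} \<longleftrightarrow> \<not> e \<subseteq> X - B" if "e \<in> corona_edges E n w T" for e
    using that by fast
  then show ?thesis
    using assms unfolding vertex_cover_def indep_def by simp
qed

lemma shifts_vertex_cover_ideal:
  fixes sh :: "nat \<Rightarrow> 'v mon list" and d :: "nat \<Rightarrow> ('v, 'k::field) mpoly mat"
  assumes "minimal_free_resolution X (vertex_cover_ideal X (corona_edges E n w T)) sh d"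
  shows "set (sh k) = {char_mon (X - A) | A. indep A \<and> card A + k = n}"
proof -
  have "corona_resolution V E n w T (vertex_cover_ideal X (corona_edges E n w T)) sh d"
  proof (intro corona_resolution.intro corona_resolution_axioms.intro)
    show "clique_corona V E n w T" by (rule clique_corona_axioms)
    show "graded_resolution X (vertex_cover_ideal X (corona_edges E n w T)) sh d"
      by (rule graded_resolution.intro[OF assms ideal_vertex_cover_ideal[OF finite_X]])
    fix a :: "'v mon" assume a: "Poly_Mapping.keys a \<subseteq> X"
    show "(x_mon a :: ('v, 'k) mpoly) \<in> vertex_cover_ideal X (corona_edges E n w T) \<longleftrightarrow>
        indep (X - Poly_Mapping.keys a)"
      unfolding x_mon_mem_vertex_cover_ideal[OF finite_X] vertex_cover_iff_indep[OF a] using a by simp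
  qed
  then show ?thesis by (rule corona_resolution.shifts_eq)
qed

text \<open>Equal sizes of the independent sets give the antichain property, and their exchange
  property carries over to the complements. The empty family generates the zero ideal.\<close>

lemma exchange_family_independent:
  assumes M: "M = {} \<or> M = {char_mon (X - A) | A. indep A \<and> card A + k = n}"
  shows "\<exists>xs. exchange_family X M xs"
proof -
  have "finite (\<Union>i\<in>{1..n}. T i)" "finite V"
    using finite_T V_sub_X finite_X finite_subset by auto
  then obtain vs ts where lists: "set vs = V" "distinct vs" "set ts = (\<Union>i\<in>{1..n}. T i)" "distinct ts"
    by (metis finite_distinct_list)
  \<comment> \<open>The vertices of \<Gamma> come first, as \<open>exchange\<close>
    requires.\<close>
  define xs where "xs = vs @ ts"
  have set_xs: "set xs = X"
    by (simp add: xs_def lists X_def corona_verts_def)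
  have distinct_xs: "distinct xs"
  proof -
    have "V \<inter> (\<Union>i\<in>{1..n}. T i) = {}"
      unfolding Int_UN_distrib using T_V by (simp add: Int_commute)
    then show ?thesis
      by (simp add: xs_def lists)
  qed
  have M_E: "\<exists>A. a = char_mon (X - A) \<and> indep A \<and> card A + k = n" if "a \<in> M" for a
    using M that by auto
  have fin: "finite (X - A)" for A using finite_X by simp
  have "exchange_family X M xs"
  proof
    have "M \<subseteq> (\<lambda>A. char_mon (X - A)) ` Pow X"
    proof
      fix a assume "a \<in> M"
      from M_E[OF this] obtain A where "a = char_mon (X - A)" "A \<subseteq> X"
        unfolding indep_def by blast
      then show "a \<in> (\<lambda>A. char_mon (X - A)) ` Pow X" by blast
    qed
    then show "finite M"
      by (rule finite_subset) (simp add: finite_X)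
    show "Poly_Mapping.keys a \<subseteq> X" if "a \<in> M" for a
      using M_E[OF that] keys_char_mon[OF fin] by auto
    show "a = b" if ab: "a \<in> M" "b \<in> M" "mon_dvd a b" for a b
    proof -
      obtain A where A: "a = char_mon (X - A)" "indep A" "card A + k = n" using M_E[OF ab(1)] by blast
      obtain B where B: "b = char_mon (X - B)" "indep B" "card B + k = n" using M_E[OF ab(2)] by blast
      have "X - A \<subseteq> X - B"
        using keys_mon_dvd[OF ab(3)] by (simp add: A B keys_char_mon[OF fin])
      then have "B \<subseteq> A" using B by (auto simp: indep_def)
      then have "B = A" using A B indep_finite card_subset_eq[of A B] by simp
      then show ?thesis using A B by simp
    qed
    show "distinct xs" "set xs = X" by (fact distinct_xs, fact set_xs)
    fix u v t
    assume u: "u \<in> M" and v: "v \<in> M" and t: "t < length xs"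
      and agree: "\<And>i. i < t \<Longrightarrow> Poly_Mapping.lookup u (xs ! i) = Poly_Mapping.lookup v (xs ! i)"
      and less: "Poly_Mapping.lookup u (xs ! t) > Poly_Mapping.lookup v (xs ! t)"
    obtain A where A: "u = char_mon (X - A)" "indep A" "card A + k = n" using M_E[OF u] by blast
    obtain B where B: "v = char_mon (X - B)" "indep B" "card B + k = n" using M_E[OF v] by blast
    have in_X: "xs ! i \<in> X" if "i < length xs" for i using that set_xs nth_mem by blast
    \<comment> \<open>A larger exponent in \<open>u\<close> means that the vertex is missing from
      \<open>A\<close> and present in \<open>B\<close>.\<close>
    have xt: "xs ! t \<in> B" "xs ! t \<notin> A"
      using less in_X[OF t] by (auto simp: A B lookup_char_mon[OF fin] split: if_splits)
    have "xs ! i \<in> A \<longleftrightarrow> xs ! i \<in> B" if "i < t" for i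
      using agree[OF that] in_X[of i] that t by (auto simp: A B lookup_char_mon[OF fin] split: if_splits)
    then obtain j where j: "t < j" "j < length xs" "xs ! j \<notin> B" "indep (insert (xs ! j) (B - {xs ! t}))"
      using exchange[OF lists(1,3) xs_def A(2) B(2) _ t xt] A(3) B(3) by auto
    let ?B = "insert (xs ! j) (B - {xs ! t})"
    have neq: "xs ! j \<noteq> xs ! t" using j xt by auto
    have "Poly_Mapping.single (xs ! t) 1 + (v - Poly_Mapping.single (xs ! j) 1) = char_mon (X - ?B)"
      using neq j xt in_X[OF t] in_X[OF j(2)]
      by (intro poly_mapping_eqI)
        (auto simp: B lookup_add lookup_minus lookup_single_if lookup_char_mon[OF fin])
    moreover have "char_mon (X - ?B) \<in> M"
    proof -
      have "card ?B = Suc (card (B - {xs ! t}))"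
        using j(3) indep_finite[OF B(2)] by (intro card_insert_disjoint) auto
      also have "\<dots> = card B"
        by (rule card_Suc_Diff1[OF indep_finite[OF B(2)] xt(1)])
      finally have "card ?B + k = n" using B(3) by (simp only:)
      moreover have "M = {char_mon (X - A) | A. indep A \<and> card A + k = n}"
        using M v by blast
      ultimately show ?thesis using j(4) by blast
    qed
    ultimately have "Poly_Mapping.single (xs ! t) 1 + (v - Poly_Mapping.single (xs ! j) 1) \<in> M"
      by (simp only:)
    moreover have "Poly_Mapping.lookup v (xs ! j) > 0"
      using j in_X by (simp add: B lookup_char_mon[OF fin])
    ultimately show "\<exists>j. t < j \<and> j < length xs \<and> Poly_Mapping.lookup v (xs ! j) > 0 \<and>
        Poly_Mapping.single (xs ! t) 1 + (v - Poly_Mapping.single (xs ! j) 1) \<in> M"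
      using j by blast
  qed
  then show ?thesis by blast
qed

end

theorem theorem2p17:
  fixes V :: "'v set" and E :: "'v set set" and n :: nat
    and w :: "nat \<Rightarrow> 'v" and t :: "nat \<Rightarrow> nat" and T :: "nat \<Rightarrow> 'v set"
    and G_verts :: "'v set" and G_edges :: "'v set set"
    and J :: "('v, 'k::field) mpoly set"
  assumes "simple_graph V E" and "bij_betw w {1..n} V"
    and "\<forall>i\<in>{1..n}. finite (T i) \<and> card (T i) = t i"
    and "disjoint_family_on T {1..n}" and "\<forall>i\<in>{1..n}. T i \<inter> V = {}"
    and "\<forall>i\<in>{1..n}. t i \<ge> 2"
    and "G_verts = corona_verts V n T" and "G_edges = corona_edges E n w T"
    and "J = vertex_cover_ideal G_verts G_edges"
  shows "\<forall>k. weakly_polymatroidal G_verts (homological_shift_ideal G_verts k J) \<and>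
             linear_quotients G_verts (homological_shift_ideal G_verts k J)"
proof
  fix k
  interpret clique_corona V E n w T
    using assms(1-6) by unfold_locales auto
  have G: "G_verts = X" by (simp add: X_def assms)
  define M where "M = {char_mon (X - A) | A. indep A \<and> card A + k = n}"
  \<comment> \<open>Every resolution yields the same shifts, so collecting them over all resolutions
    in \<open>multigraded_shifts\<close> adds nothing beyond \<open>M\<close>.\<close>
  have shifts: "set (sh k) = M" if "minimal_free_resolution X J sh d" for sh d
    using shifts_vertex_cover_ideal that unfolding M_def assms(8,9) G by blast
  \<comment> \<open>The alternative \<open>{}\<close> spares the construction of a resolution.\<close>
  have "multigraded_shifts X J k = {} \<or> multigraded_shifts X J k = M"
  proof (cases "\<exists>sh d. minimal_free_resolution X J sh d")
    case True
    then have "multigraded_shifts X J k = M"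
      unfolding multigraded_shifts_def using shifts by blast
    then show ?thesis by blast
  next
    case False
    then show ?thesis by (simp add: multigraded_shifts_def)
  qed
  then obtain xs where "exchange_family X (multigraded_shifts X J k) xs"
    using exchange_family_independent unfolding M_def by blast
  then show "weakly_polymatroidal G_verts (homological_shift_ideal G_verts k J) \<and>
      linear_quotients G_verts (homological_shift_ideal G_verts k J)"
    unfolding G homological_shift_ideal_def
    using exchange_family.weakly_polymatroidal exchange_family.linear_quotients by blast
qed

end
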